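(* For $n\ge 1$, let $\widetilde{X}_{P_n}=\sum_{I\vDash n}\varepsilon^I\Psi^I\in\mathrm{NSym}$. Then $\rho(\widetilde{X}_{P_n})=X_{P_n}$ is the chromatic symmetric function of the path $P_n$ on $n$ vertices, and \[ \widetilde{X}_{P_n}=\sum_{I=(i_1,\dots,i_l)\vDash n} i_1(i_2-1)\cdots(i_l-1)\,\Lambda^I=\frac12\sum_{I\in\mathcal{C}_n}2^{m_1(I)}R_I . \]
   Context: $\mathrm{NSym}=\mathbb{Q}\langle\Lambda_1,\Lambda_2,\dots\rangle$ is the free associative algebra on noncommuting indeterminates $\Lambda_k$, with $\Lambda_0=1$. Put $\lambda(t)=\sum_{n\ge0}\Lambda_nt^n$ ($t$ a commuting variable), define $S_n$ by $\sum_{n\ge0}S_nt^n=\sigma(t)=1/\lambda(-t)$, and $\Psi_n$ by $\sum_{n\ge1}\Psi_nt^{n-1}=\lambda(-t)\sigma'(t)$. For a composition $I=(i_1,\dots,i_l)$ (finite sequence of positive integers) of $n$, write $I\vDash n$, $\ell(I)=l$, $\Lambda^I=\Lambda_{i_1}\cdots\Lambda_{i_l}$, $S^I=S_{i_1}\cdots S_{i_l}$, $\Psi^I=\Psi_{i_1}\cdots\Psi_{i_l}$, $\varepsilon^I=(-1)^{n-\ell(I)}$, and $m_1(I)$ = number of parts equal to $1$. Write $J\preceq I$ if $I$ is a refinement of $J$ (obtained by splitting parts of $J$ into consecutive parts). The ribbon Schur functions are defined by $\varepsilon^IR_I=\sum_{J\preceq I}\varepsilon^JS^J$. $\mathcal{C}_n$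 is the set of compositions of $n$ all of whose parts are in $\{1,2\}$ and whose last part is $1$. $\rho\colon\mathrm{NSym}\to\mathrm{Sym}$ is the algebra homomorphism letting variables commute, $\rho(\Lambda_k)=e_k$ (the elementary symmetric function). The chromatic symmetric function of a graph $G$ is $X_G=\sum_c\prod_{v}x_{c(v)}$ over proper colorings $c\colon V(G)\to\{1,2,\dots\}$. *)

theory Defs
  imports
    "HOL-Library.Poly_Mapping"
    "HOL-Library.FuncSet"
    "HOL-Computational_Algebra.Formal_Power_Series"
begin

section \<open>Compositions\<close>

typedef composition = "{I :: nat list. 0 \<notin> set I}"
  morphisms parts Composition
  by (rule exI[of _ "[]"]) simp

setup_lifting type_definition_composition

text \<open>Concatenation, written additively, makes the compositions the free monoid on the
  positive integers; addition is not commutative.\<close>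

instantiation composition :: monoid_add
begin

lift_definition zero_composition :: composition is "[]" by simp

lift_definition plus_composition :: "composition \<Rightarrow> composition \<Rightarrow> composition"
  is "(@)" by simp

instance by standard (transfer; simp)+

end

definition compositions :: "nat \<Rightarrow> composition set" where
  "compositions n = {I. sum_list (parts I) = n}"

abbreviation clength :: "composition \<Rightarrow> nat" where
  "clength I \<equiv> length (parts I)"

definition eps :: "composition \<Rightarrow> rat" where
  "eps I = (- 1) ^ (sum_list (parts I) - clength I)"

definition m1 :: "composition \<Rightarrow> nat" where
  "m1 I = count_list (parts I) 1"

text \<open>The blocks \<open>Ks\<close> are automatically nonempty, because the parts of \<open>J\<close> are positive.\<close>

definition coarser :: "composition \<Rightarrow> composition \<Rightarrow> bool"  (infix \<open>\<preceq>\<close> 50) where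
  "J \<preceq> I \<longleftrightarrow> (\<exists>Ks :: nat list list. concat Ks = parts I \<and> map sum_list Ks = parts J)"

definition C12 :: "nat \<Rightarrow> composition set" where
  "C12 n = {I \<in> compositions n.
     set (parts I) \<subseteq> {1, 2} \<and> parts I \<noteq> [] \<and> last (parts I) = 1}"

lemma parts_pos: "i \<in> set (parts I) \<Longrightarrow> 0 < i"
  using parts[of I] by (cases i) auto

lemma parts_add [simp]: "parts (I + J) = parts I @ parts J"
  by (rule plus_composition.rep_eq)

lemma parts_zero [simp]: "parts 0 = []"
  by (rule zero_composition.rep_eq)

lemma clength_le_sum: "clength I \<le> sum_list (parts I)"
proof -
  have "length xs \<le> sum_list xs" if "0 \<notin> set xs" for xs :: "nat list"
    using that by (induction xs) auto
  then show ?thesis using parts[of I] by simp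
qed

lemma finite_compositions: "finite (compositions n)"
proof -
  have "parts ` compositions n \<subseteq> {xs. set xs \<subseteq> {..n} \<and> length xs \<le> n}"
    using clength_le_sum by (auto simp: compositions_def member_le_sum_list)
  moreover have "finite {xs :: nat list. set xs \<subseteq> {..n} \<and> length xs \<le> n}"
    by (rule finite_lists_length_le) simp
  ultimately have "finite (parts ` compositions n)"
    by (rule finite_subset)
  then show ?thesis
    by (rule finite_imageD) (simp add: inj_on_def parts_inject)
qed

lemma coarser_compositions: "J \<preceq> I \<Longrightarrow> I \<in> compositions n \<Longrightarrow> J \<in> compositions n"
proof -
  have "sum_list (concat Ks) = sum_list (map sum_list Ks)" for Ks :: "nat list list"
    by (induction Ks) auto
  then show "J \<preceq> I \<Longrightarrow> I \<in> compositions n \<Longrightarrow> J \<in> compositions n"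
    by (auto simp: coarser_def compositions_def) metis
qed

lemma finite_coarser: "finite {J. J \<preceq> I}"
proof (rule finite_subset)
  show "{J. J \<preceq> I} \<subseteq> compositions (sum_list (parts I))"
    using coarser_compositions[of _ I "sum_list (parts I)"] by (auto simp: compositions_def)
qed (rule finite_compositions)

section \<open>Noncommutative symmetric functions\<close>

text \<open>The monoid algebra of the free monoid on the positive integers is the free associative
  algebra; the composition \<open>I\<close> is the monomial \<open>\<Lambda>\<^sup>I\<close>.\<close>

type_synonym nsym = "composition \<Rightarrow>\<^sub>0 rat"

definition nscale :: "rat \<Rightarrow> nsym \<Rightarrow> nsym"  (infixr \<open>\<odot>\<close> 75) where
  "c \<odot> f = Poly_Mapping.map ((*) c) f"

definition Lam :: "nat \<Rightarrow> nsym" where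
  "Lam k = (if k = 0 then 1 else Poly_Mapping.single (Composition [k]) 1)"

definition lam_gf :: "nsym fps" where
  "lam_gf = Abs_fps Lam"

text \<open>Over a noncommutative ring the library has one-sided inverses of power series; the constant
  term of \<open>\<lambda>(-t)\<close> is \<open>1\<close>, so the right inverse is two-sided.\<close>

definition sigma_gf :: "nsym fps" where
  "sigma_gf = fps_right_inverse (lam_gf oo (- fps_X)) 1"

definition Sn :: "nat \<Rightarrow> nsym" where
  "Sn n = fps_nth sigma_gf n"

text \<open>The value \<open>Psi 0\<close> is irrelevant.\<close>

definition Psi :: "nat \<Rightarrow> nsym" where
  "Psi n = fps_nth ((lam_gf oo (- fps_X)) * fps_deriv sigma_gf) (n - 1)"

definition npow :: "(nat \<Rightarrow> nsym) \<Rightarrow> composition \<Rightarrow> nsym" where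
  "npow F I = prod_list (map F (parts I))"

definition ribbon :: "composition \<Rightarrow> nsym" where
  "ribbon I = eps I \<odot> (\<Sum>J | J \<preceq> I. eps J \<odot> npow Sn J)"

definition Xtilde :: "nat \<Rightarrow> nsym" where
  "Xtilde n = (\<Sum>I\<in>compositions n. eps I \<odot> npow Psi I)"

lemma lookup_nscale [simp]:
  "Poly_Mapping.lookup (c \<odot> f) I = c * Poly_Mapping.lookup f I"
  by (simp add: nscale_def Poly_Mapping.map.rep_eq when_def)

lemma nscale_nscale [simp]: "a \<odot> (b \<odot> f) = (a * b) \<odot> f"
  by (rule poly_mapping_eqI) simp

lemma one_nscale [simp]: "1 \<odot> f = f"
  by (rule poly_mapping_eqI) simp

lemma eps_sq [simp]: "eps I * eps I = 1"
  by (simp add: eps_def flip: power_add mult_2)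

lemma eps_ribbon: "eps I \<odot> ribbon I = (\<Sum>J | J \<preceq> I. eps J \<odot> npow Sn J)"
  by (simp add: ribbon_def)

lemma npow_Lam: "npow Lam I = Poly_Mapping.single I 1"
proof -
  have "prod_list (map Lam xs) = Poly_Mapping.single (Composition xs) 1"
    if "0 \<notin> set xs" for xs
    using that
  proof (induction xs)
    case Nil
    have "Composition [] = 0"
      by (simp flip: parts_inject add: Composition_inverse)
    then show ?case by simp
  next
    case (Cons x xs)
    have "Composition [x] + Composition xs = Composition (x # xs)"
      using Cons.prems by (simp flip: parts_inject add: Composition_inverse)
    then show ?case using Cons by (simp add: Lam_def mult_single)
  qed
  then show ?thesis
    using parts[of I] by (simp add: npow_def parts_inverse)
qed

lemma sigma_gf_inverse:
  "(lam_gf oo (- fps_X)) * sigma_gf = 1"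
  "sigma_gf * (lam_gf oo (- fps_X)) = 1"
proof -
  let ?f = "lam_gf oo (- fps_X)"
  have f0: "fps_nth lam_gf 0 = 1"
    by (simp add: lam_gf_def Lam_def)
  show "?f * sigma_gf = 1"
    unfolding sigma_gf_def by (rule fps_right_inverse) (simp add: f0)
  have "fps_left_inverse ?f 1 = sigma_gf"
    unfolding sigma_gf_def
    by (rule fps_left_inverse_eq_fps_right_inverse) (simp_all add: f0)
  moreover have "fps_left_inverse ?f 1 * ?f = 1"
    by (rule fps_left_inverse) (simp add: f0)
  ultimately show "sigma_gf * ?f = 1" by simp
qed

section \<open>Symmetric functions\<close>

typedef pos = "{n :: nat. 0 < n}"
  by blast

text \<open>Formal power series over the rationals in the commuting variables \<open>x\<^sub>1, x\<^sub>2, \<dots>\<close>,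
  given by their coefficients.\<close>

typedef xseries = "UNIV :: ((pos \<Rightarrow>\<^sub>0 nat) \<Rightarrow> rat) set"
  morphisms xcoeff Xseries ..

setup_lifting type_definition_xseries

lemma xseries_eqI: "(\<And>m. xcoeff f m = xcoeff g m) \<Longrightarrow> f = g"
  by (metis ext xcoeff_inject)

lemma finite_below:
  fixes m :: "'a \<Rightarrow>\<^sub>0 nat"
  shows "finite {a. \<exists>b. a + b = m}"
proof -
  let ?A = "{a. \<exists>b. a + b = m}"
  let ?K = "Poly_Mapping.keys m"
  let ?r = "\<lambda>a. restrict (Poly_Mapping.lookup a) ?K"
  have out: "Poly_Mapping.lookup a k = 0" if "a \<in> ?A" "k \<notin> ?K" for a k
    using that by (auto simp: in_keys_iff lookup_add)
  have "?r ` ?A \<subseteq> (\<Pi>\<^sub>E k\<in>?K. {..Poly_Mapping.lookup m k})"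
    by (auto simp: lookup_add)
  moreover have "finite (\<Pi>\<^sub>E k\<in>?K. {..Poly_Mapping.lookup m k})"
    by (intro finite_PiE) auto
  ultimately have "finite (?r ` ?A)" by (rule finite_subset)
  moreover have "inj_on ?r ?A"
  proof (rule inj_onI, rule poly_mapping_eqI)
    fix a a' k assume a: "a \<in> ?A" "a' \<in> ?A" "?r a = ?r a'"
    show "Poly_Mapping.lookup a k = Poly_Mapping.lookup a' k"
    proof (cases "k \<in> ?K")
      case True
      then show ?thesis using fun_cong[OF a(3), of k] by simp
    next
      case False
      then show ?thesis using out a(1,2) by simp
    qed
  qed
  ultimately show ?thesis by (rule finite_imageD)
qed

lemma finite_splittings:
  fixes m :: "'a \<Rightarrow>\<^sub>0 nat"
  shows "finite {(a, b). a + b = m}"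
proof (rule finite_subset)
  show "{(a, b). a + b = m} \<subseteq> {a. \<exists>b. a + b = m} \<times> {a. \<exists>b. a + b = m}"
    by (auto intro: add.commute)
  show "finite ({a. \<exists>b. a + b = m} \<times> {a. \<exists>b. a + b = m})"
    using finite_below[of m] by simp
qed

instantiation xseries :: comm_ring_1
begin

lift_definition zero_xseries :: xseries is "\<lambda>_. 0" .

lift_definition one_xseries :: xseries is "\<lambda>m. if m = 0 then 1 else 0" .

lift_definition plus_xseries :: "xseries \<Rightarrow> xseries \<Rightarrow> xseries"
  is "\<lambda>f g m. f m + g m" .

lift_definition minus_xseries :: "xseries \<Rightarrow> xseries \<Rightarrow> xseries"
  is "\<lambda>f g m. f m - g m" .

lift_definition uminus_xseries :: "xseries \<Rightarrow> xseries"
  is "\<lambda>f m. - f m" .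

lift_definition times_xseries :: "xseries \<Rightarrow> xseries \<Rightarrow> xseries"
  is "\<lambda>f g m. \<Sum>(a, b)\<in>{(a, b). a + b = m}. f a * g b" .

instance
proof
  fix f g h :: xseries
  show "f * g * h = f * (g * h)"
  proof (transfer, rule ext)
    fix f g h :: "(pos \<Rightarrow>\<^sub>0 nat) \<Rightarrow> rat" and m
    let ?P = "\<lambda>m :: pos \<Rightarrow>\<^sub>0 nat. {(a, b). a + b = m}"
    have "(\<Sum>(a, b)\<in>?P m. (\<Sum>(a, b)\<in>?P a. f a * g b) * h b)
        = (\<Sum>(p, q)\<in>(SIGMA p:?P m. ?P (fst p)). f (fst q) * g (snd q) * h (snd p))"
      by (subst sum.Sigma[symmetric])
        (auto simp: finite_splittings[unfolded case_prod_unfold] sum_distrib_right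
          case_prod_unfold intro!: sum.cong)
    also have "\<dots> = (\<Sum>(p, q)\<in>(SIGMA p:?P m. ?P (snd p)). f (fst p) * (g (fst q) * h (snd q)))"
      by (rule sum.reindex_bij_witness[where
            i = "\<lambda>((a, b), (c, d)). ((a + c, d), (a, c))" and
            j = "\<lambda>((a, b), (c, d)). ((c, d + b), (d, b))"])
        (auto simp: add.assoc mult.assoc)
    also have "\<dots> = (\<Sum>(a, b)\<in>?P m. f a * (\<Sum>(a, b)\<in>?P b. g a * h b))"
      by (subst sum.Sigma[symmetric])
        (auto simp: finite_splittings[unfolded case_prod_unfold] sum_distrib_left
          case_prod_unfold intro!: sum.cong)
    finally show "(\<Sum>(a, b)\<in>?P m. (\<Sum>(a, b)\<in>?P a. f a * g b) * h b)
        = (\<Sum>(a, b)\<in>?P m. f a * (\<Sum>(a, b)\<in>?P b. g a * h b))" .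
  qed
  show "f * g = g * f"
  proof (transfer, rule ext)
    fix f g :: "(pos \<Rightarrow>\<^sub>0 nat) \<Rightarrow> rat" and m
    show "(\<Sum>(a, b)\<in>{(a, b). a + b = m}. f a * g b)
        = (\<Sum>(a, b)\<in>{(a, b). a + b = m}. g a * f b)"
      by (rule sum.reindex_bij_witness[where i = prod.swap and j = prod.swap])
        (auto simp: add.commute mult.commute)
  qed
  show "1 * f = f"
  proof (transfer, rule ext)
    fix f :: "(pos \<Rightarrow>\<^sub>0 nat) \<Rightarrow> rat" and m
    have "(\<Sum>(a, b)\<in>{(a, b). a + b = m}. (if a = 0 then 1 else 0) * f b)
        = (\<Sum>(a, b)\<in>{(0 :: pos \<Rightarrow>\<^sub>0 nat, m)}. (if a = 0 then 1 else 0) * f b)"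
      by (rule sum.mono_neutral_right) (auto simp: finite_splittings split: if_splits)
    then show "(\<Sum>(a, b)\<in>{(a, b). a + b = m}. (if a = 0 then 1 else 0) * f b) = f m"
      by simp
  qed
  show "(f + g) * h = f * h + g * h"
    by (transfer, rule ext)
      (simp add: distrib_right case_prod_unfold sum.distrib)
  show "(0 :: xseries) \<noteq> 1"
    by transfer (auto dest: fun_cong[of _ _ 0])
qed (transfer; simp add: fun_eq_iff)+

end

lift_definition xscale :: "rat \<Rightarrow> xseries \<Rightarrow> xseries" is "\<lambda>c f m. c * f m" .

lift_definition xvar :: "pos \<Rightarrow> xseries"
  is "\<lambda>i m. if m = Poly_Mapping.single i 1 then 1 else 0" .

text \<open>Coefficientwise sum of a family of series; meaningful when every monomial occurs in only
  finitely many members of the family.\<close>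

lift_definition formal_sum :: "'i set \<Rightarrow> ('i \<Rightarrow> xseries) \<Rightarrow> xseries"
  is "\<lambda>A F m. \<Sum>i | i \<in> A \<and> F i m \<noteq> 0. F i m" .

definition Sym :: "xseries set" where
  "Sym = {f. (\<forall>\<pi>. bij \<pi> \<longrightarrow> (\<forall>m. xcoeff f (Poly_Mapping.map_key \<pi> m) = xcoeff f m)) \<and>
     (\<exists>d. \<forall>m. d < (\<Sum>i\<in>Poly_Mapping.keys m. Poly_Mapping.lookup m i) \<longrightarrow> xcoeff f m = 0)}"

definition esym :: "nat \<Rightarrow> xseries" where
  "esym k = formal_sum {T. finite T \<and> card T = k} (\<lambda>T. \<Prod>i\<in>T. xvar i)"

definition rho :: "nsym \<Rightarrow> xseries" where
  "rho f = (\<Sum>I\<in>Poly_Mapping.keys f.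
     xscale (Poly_Mapping.lookup f I) (prod_list (map esym (parts I))))"

section \<open>Chromatic symmetric functions\<close>

text \<open>A graph is a pair of a vertex set and a set of edges, each edge being the set of its ends.\<close>

type_synonym 'v graph = "'v set \<times> 'v set set"

definition proper_colorings :: "'v graph \<Rightarrow> ('v \<Rightarrow> pos) set" where
  "proper_colorings G =
     {c \<in> fst G \<rightarrow>\<^sub>E UNIV. \<forall>u\<in>fst G. \<forall>v\<in>fst G. {u, v} \<in> snd G \<longrightarrow> c u \<noteq> c v}"

definition chromatic_sym :: "'v graph \<Rightarrow> xseries" where
  "chromatic_sym G = formal_sum (proper_colorings G) (\<lambda>c. \<Prod>v\<in>fst G. xvar (c v))"

definition path_graph :: "nat \<Rightarrow> nat graph" where
  "path_graph n = ({1..n}, {{i, i + 1} | i. 1 \<le> i \<and> i < n})"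


section \<open>Basic facts\<close>

subsection \<open>Products of variables and formal sums\<close>

lemma xcoeff_simps [simp]:
  "xcoeff 0 m = 0"
  "xcoeff 1 m = (if m = 0 then 1 else 0)"
  "xcoeff (f + g) m = xcoeff f m + xcoeff g m"
  "xcoeff (xscale c f) m = c * xcoeff f m"
  by (simp_all add: zero_xseries.rep_eq one_xseries.rep_eq plus_xseries.rep_eq xscale.rep_eq)

lemma xcoeff_prod_xvar:
  assumes "finite V"
  shows "xcoeff (\<Prod>v\<in>V. xvar (c v)) m
    = (if m = (\<Sum>v\<in>V. Poly_Mapping.single (c v) 1) then 1 else 0)"
  using assms
proof (induction V arbitrary: m rule: finite_induct)
  case (insert v V)
  let ?s = "Poly_Mapping.single (c v) (1::nat)"
  let ?p = "\<Sum>v\<in>V. Poly_Mapping.single (c v) (1::nat)"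
  have "xcoeff (xvar (c v) * (\<Prod>v\<in>V. xvar (c v))) m
      = (\<Sum>(a, b)\<in>{(a, b). a + b = m}. if (a, b) = (?s, ?p) then 1 else 0)"
    unfolding times_xseries.rep_eq
    by (rule sum.cong) (auto simp: insert.IH xvar.rep_eq split: if_splits)
  also have "\<dots> = (\<Sum>q\<in>{(a, b). a + b = m}. if q = (?s, ?p) then 1 else 0)"
    by (simp only: case_prod_unfold prod.collapse)
  also have "\<dots> = (if m = ?s + ?p then 1 else 0)"
    by (subst sum.delta[OF finite_splittings]) auto
  finally show ?case using insert.hyps by simp
qed simp

lemma keys_sum_single:
  assumes "finite V"
  shows "Poly_Mapping.keys (\<Sum>v\<in>V. Poly_Mapping.single (c v) (1::nat)) = c ` V"
  using assms
proof (induction V rule: finite_induct)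
  case (insert v V)
  have "Poly_Mapping.keys (a + b) = Poly_Mapping.keys a \<union> Poly_Mapping.keys b"
    for a b :: "'b \<Rightarrow>\<^sub>0 nat"
    by (auto simp: in_keys_iff lookup_add)
  then show ?case using insert by simp
qed simp

lemma locally_finite_colorings:
  assumes "finite V"
  shows "finite {c \<in> V \<rightarrow>\<^sub>E UNIV. xcoeff (\<Prod>v\<in>V. xvar (c v)) m \<noteq> 0}"
proof (rule finite_subset)
  show "{c \<in> V \<rightarrow>\<^sub>E UNIV. xcoeff (\<Prod>v\<in>V. xvar (c v)) m \<noteq> 0}
      \<subseteq> V \<rightarrow>\<^sub>E Poly_Mapping.keys m"
    using assms
    by (auto simp: xcoeff_prod_xvar keys_sum_single simp del: One_nat_def split: if_splits)
  show "finite (V \<rightarrow>\<^sub>E Poly_Mapping.keys m)"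
    using assms by (intro finite_PiE) auto
qed

lemma xcoeff_chromatic_sym:
  assumes "finite (fst G)"
  shows "xcoeff (chromatic_sym G) m = of_nat (card {c \<in> proper_colorings G.
    (\<Sum>v\<in>fst G. Poly_Mapping.single (c v) 1) = m})"
proof -
  have "{c. c \<in> proper_colorings G \<and> xcoeff (\<Prod>v\<in>fst G. xvar (c v)) m \<noteq> 0}
      = {c \<in> proper_colorings G. (\<Sum>v\<in>fst G. Poly_Mapping.single (c v) 1) = m}"
    by (auto simp: xcoeff_prod_xvar[OF assms] split: if_splits)
  then show ?thesis
    by (simp add: chromatic_sym_def formal_sum.rep_eq xcoeff_prod_xvar[OF assms])
qed

lemma eq_sum_single_iff:
  assumes "finite T"
  shows "m = (\<Sum>i\<in>T. Poly_Mapping.single i (1::nat))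
    \<longleftrightarrow> Poly_Mapping.keys m = T \<and> (\<forall>i. Poly_Mapping.lookup m i \<le> 1)"
proof -
  have l: "Poly_Mapping.lookup (\<Sum>i\<in>T. Poly_Mapping.single i (1::nat)) j = (if j \<in> T then 1 else 0)"
    for j
    using assms by (simp add: lookup_sum lookup_single when_def)
  have "m = (\<Sum>i\<in>T. Poly_Mapping.single i (1::nat))
      \<longleftrightarrow> (\<forall>j. Poly_Mapping.lookup m j = (if j \<in> T then 1 else 0))"
    unfolding poly_mapping_eq_iff fun_eq_iff l ..
  also have "\<dots> \<longleftrightarrow> (\<forall>j. (j \<in> Poly_Mapping.keys m \<longleftrightarrow> j \<in> T) \<and> Poly_Mapping.lookup m j \<le> 1)"
    unfolding in_keys_iff by (intro all_cong1) (auto simp: le_Suc_eq)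
  finally show ?thesis by blast
qed

lemma xcoeff_esym:
  "xcoeff (esym k) m = (if card (Poly_Mapping.keys m) = k \<and>
     (\<forall>i. Poly_Mapping.lookup m i \<le> 1) then 1 else 0)"
proof -
  define K where "K = Poly_Mapping.keys m"
  define Q where "Q \<longleftrightarrow> (\<forall>i. Poly_Mapping.lookup m i \<le> 1)"
  have K: "finite K" by (simp add: K_def)
  have c: "xcoeff (\<Prod>i\<in>T. xvar i) m = (if K = T \<and> Q then 1 else 0)" if "finite T" for T
    using xcoeff_prod_xvar[OF that, of "\<lambda>i. i" m]
    unfolding eq_sum_single_iff[OF that] K_def Q_def .
  have nz: "xcoeff (\<Prod>i\<in>T. xvar i) m \<noteq> 0 \<longleftrightarrow> K = T \<and> Q" if "finite T" for T
    unfolding c[OF that] by simp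
  have "{T. T \<in> {T. finite T \<and> card T = k} \<and> xcoeff (\<Prod>i\<in>T. xvar i) m \<noteq> 0}
      = {T. T = K \<and> card K = k \<and> Q}"
    using nz K by blast
  also have "\<dots> = (if card K = k \<and> Q then {K} else {})"
    by auto
  finally have "xcoeff (esym k) m
      = (\<Sum>T\<in>(if card K = k \<and> Q then {K} else {}). xcoeff (\<Prod>i\<in>T. xvar i) m)"
    unfolding esym_def formal_sum.rep_eq by (rule sum.cong) (rule refl)
  also have "\<dots> = (if card K = k \<and> Q then 1 else 0)"
    using c[OF K] by simp
  finally show ?thesis unfolding K_def Q_def .
qed

lemma esym_0: "esym 0 = 1"
  by (rule xseries_eqI) (auto simp: xcoeff_esym)

subsection \<open>The subalgebra of symmetric functions\<close>

abbreviation mdeg :: "(pos \<Rightarrow>\<^sub>0 nat) \<Rightarrow> nat" where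
  "mdeg m \<equiv> \<Sum>i\<in>Poly_Mapping.keys m. Poly_Mapping.lookup m i"

lemma mdeg_superset:
  "finite K \<Longrightarrow> Poly_Mapping.keys m \<subseteq> K \<Longrightarrow> mdeg m = (\<Sum>i\<in>K. Poly_Mapping.lookup m i)"
  by (rule sum.mono_neutral_left) (auto simp: in_keys_iff)

lemma mdeg_add: "mdeg (a + b) = mdeg a + mdeg b"
proof -
  let ?K = "Poly_Mapping.keys a \<union> Poly_Mapping.keys b"
  have "mdeg (a + b) = (\<Sum>i\<in>?K. Poly_Mapping.lookup (a + b) i)"
    by (rule mdeg_superset) (auto simp: Poly_Mapping.keys_add)
  also have "\<dots> = mdeg a + mdeg b"
    by (simp add: lookup_add sum.distrib mdeg_superset[of ?K a] mdeg_superset[of ?K b])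
  finally show ?thesis .
qed

lemma mdeg_sum_single: "finite V \<Longrightarrow> mdeg (\<Sum>v\<in>V. Poly_Mapping.single (c v) 1) = card V"
  by (induction V rule: finite_induct) (simp_all add: mdeg_add)

lemma lookup_map_key:
  "bij \<pi> \<Longrightarrow> Poly_Mapping.lookup (Poly_Mapping.map_key \<pi> m) i = Poly_Mapping.lookup m (\<pi> i)"
  unfolding map_key.rep_eq[OF bij_is_inj] by (rule comp_apply)

lemma map_key_inv:
  assumes "bij \<pi>"
  shows "Poly_Mapping.map_key (inv \<pi>) (Poly_Mapping.map_key \<pi> m) = m"
    and "Poly_Mapping.map_key \<pi> (Poly_Mapping.map_key (inv \<pi>) m) = m"
proof -
  have i: "\<pi> (inv \<pi> j) = j" "inv \<pi> (\<pi> j) = j" for j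
    using assms by (simp_all add: bij_is_surj surj_f_inv_f bij_is_inj)
  show "Poly_Mapping.map_key (inv \<pi>) (Poly_Mapping.map_key \<pi> m) = m"
    and "Poly_Mapping.map_key \<pi> (Poly_Mapping.map_key (inv \<pi>) m) = m"
    by (rule poly_mapping_eqI,
        simp only: lookup_map_key[OF assms] lookup_map_key[OF bij_imp_bij_inv[OF assms]] i)+
qed

lemma map_key_add:
  "bij \<pi> \<Longrightarrow> Poly_Mapping.map_key \<pi> (a + b :: 'a \<Rightarrow>\<^sub>0 nat)
    = Poly_Mapping.map_key \<pi> a + Poly_Mapping.map_key \<pi> b"
  by (rule poly_mapping_eqI) (simp add: lookup_map_key lookup_add)

lemma map_key_sum_single:
  assumes "bij \<pi>" "finite V"
  shows "Poly_Mapping.map_key \<pi> (\<Sum>v\<in>V. Poly_Mapping.single (\<pi> (c v)) (1::nat))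
    = (\<Sum>v\<in>V. Poly_Mapping.single (c v) 1)"
  using assms(2)
proof (induction V rule: finite_induct)
  case empty
  show ?case by (rule poly_mapping_eqI) (simp add: lookup_map_key assms(1))
next
  case (insert v V)
  then show ?case using assms(1) by (simp add: map_key_add map_key_single bij_is_inj)
qed

lemma SymI:
  assumes "\<And>\<pi> m. bij \<pi> \<Longrightarrow> xcoeff f (Poly_Mapping.map_key \<pi> m) = xcoeff f m"
    and "\<And>m. d < mdeg m \<Longrightarrow> xcoeff f m = 0"
  shows "f \<in> Sym"
  using assms unfolding Sym_def by blast

lemma Sym_perm: "f \<in> Sym \<Longrightarrow> bij \<pi> \<Longrightarrow> xcoeff f (Poly_Mapping.map_key \<pi> m) = xcoeff f m"
  by (simp add: Sym_def)

lemma Sym_bounded: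
  assumes "f \<in> Sym"
  obtains d where "\<And>m. d < mdeg m \<Longrightarrow> xcoeff f m = 0"
  using assms unfolding Sym_def by blast

lemma Sym_0: "0 \<in> Sym"
  by (rule SymI) simp_all

lemma Sym_add:
  assumes "f \<in> Sym" "g \<in> Sym"
  shows "f + g \<in> Sym"
proof -
  obtain d where d: "\<And>m. d < mdeg m \<Longrightarrow> xcoeff f m = 0"
    using Sym_bounded[OF assms(1)] by blast
  obtain d' where d': "\<And>m. d' < mdeg m \<Longrightarrow> xcoeff g m = 0"
    using Sym_bounded[OF assms(2)] by blast
  show ?thesis
    by (rule SymI[of _ "d + d'"]) (simp_all add: Sym_perm assms d d')
qed

lemma Sym_scale:
  assumes "f \<in> Sym"
  shows "xscale c f \<in> Sym"
proof -
  obtain d where d: "\<And>m. d < mdeg m \<Longrightarrow> xcoeff f m = 0"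
    using Sym_bounded[OF assms] by blast
  show ?thesis
    by (rule SymI[of _ d]) (simp_all add: Sym_perm assms d)
qed

lemma Sym_mult:
  assumes "f \<in> Sym" "g \<in> Sym"
  shows "f * g \<in> Sym"
proof -
  obtain d where d: "\<And>m. d < mdeg m \<Longrightarrow> xcoeff f m = 0"
    using Sym_bounded[OF assms(1)] by blast
  obtain d' where d': "\<And>m. d' < mdeg m \<Longrightarrow> xcoeff g m = 0"
    using Sym_bounded[OF assms(2)] by blast
  show ?thesis
  proof (rule SymI[of _ "d + d'"])
    fix \<pi> :: "pos \<Rightarrow> pos" and m assume \<pi>: "bij \<pi>"
    note \<pi>' = bij_imp_bij_inv[OF \<pi>]
    show "xcoeff (f * g) (Poly_Mapping.map_key \<pi> m) = xcoeff (f * g) m"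
      unfolding times_xseries.rep_eq
      by (rule sum.reindex_bij_witness[where
            j = "map_prod (Poly_Mapping.map_key (inv \<pi>)) (Poly_Mapping.map_key (inv \<pi>))" and
            i = "map_prod (Poly_Mapping.map_key \<pi>) (Poly_Mapping.map_key \<pi>)"])
        (auto simp: map_key_inv[OF \<pi>] Sym_perm assms \<pi> \<pi>'
          simp flip: map_key_add[OF \<pi>] map_key_add[OF \<pi>'])
  next
    fix m assume m: "d + d' < mdeg m"
    have "xcoeff f a * xcoeff g b = 0" if "a + b = m" for a b
      using m d[of a] d'[of b] unfolding that[symmetric] mdeg_add by fastforce
    then show "xcoeff (f * g) m = 0"
      unfolding times_xseries.rep_eq by (intro sum.neutral) auto
  qed
qed

lemma esym_in_Sym: "esym k \<in> Sym"
proof (rule SymI[of _ k])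
  fix \<pi> :: "pos \<Rightarrow> pos" and m :: "pos \<Rightarrow>\<^sub>0 nat" assume \<pi>: "bij \<pi>"
  have keys: "Poly_Mapping.keys m = \<pi> ` Poly_Mapping.keys (Poly_Mapping.map_key \<pi> m)"
  proof (intro set_eqI iffI)
    fix j assume j: "j \<in> Poly_Mapping.keys m"
    have "j = \<pi> (inv \<pi> j)" using \<pi> by (simp add: bij_is_surj surj_f_inv_f)
    then show "j \<in> \<pi> ` Poly_Mapping.keys (Poly_Mapping.map_key \<pi> m)"
      using j by (intro image_eqI[of _ _ "inv \<pi> j"]) (auto simp: in_keys_iff lookup_map_key \<pi>)
  qed (auto simp: in_keys_iff lookup_map_key \<pi>)
  have inj: "inj_on \<pi> A" for A
    using \<pi> by (meson bij_is_inj inj_on_subset subset_UNIV)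
  have card: "card (Poly_Mapping.keys (Poly_Mapping.map_key \<pi> m)) = card (Poly_Mapping.keys m)"
    by (subst keys) (simp add: card_image[OF inj])
  have "(\<forall>i. Poly_Mapping.lookup m (\<pi> i) \<le> 1) \<longleftrightarrow> (\<forall>i. Poly_Mapping.lookup m i \<le> 1)"
    using \<pi> by (metis bij_pointE)
  then show "xcoeff (esym k) (Poly_Mapping.map_key \<pi> m) = xcoeff (esym k) m"
    unfolding xcoeff_esym card lookup_map_key[OF \<pi>] by simp
next
  fix m assume k: "k < mdeg m"
  have "mdeg m \<le> card (Poly_Mapping.keys m)" if "\<forall>i. Poly_Mapping.lookup m i \<le> 1"
    using sum_bounded_above[of "Poly_Mapping.keys m" "Poly_Mapping.lookup m" 1] that by simp
  then have "\<not> (card (Poly_Mapping.keys m) = k \<and> (\<forall>i. Poly_Mapping.lookup m i \<le> 1))"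
    using k by (metis not_le)
  then show "xcoeff (esym k) m = 0"
    unfolding xcoeff_esym by (simp only: if_False)
qed

lemma chromatic_sym_in_Sym:
  assumes "finite (fst G)"
  shows "chromatic_sym G \<in> Sym"
proof (rule SymI[of _ "card (fst G)"])
  fix \<pi> :: "pos \<Rightarrow> pos" and m :: "pos \<Rightarrow>\<^sub>0 nat" assume \<pi>: "bij \<pi>"
  let ?w = "\<lambda>c :: 'a \<Rightarrow> pos. \<Sum>v\<in>fst G. Poly_Mapping.single (c v) (1::nat)"
  let ?h = "\<lambda>\<pi> (c :: 'a \<Rightarrow> pos). restrict (\<pi> \<circ> c) (fst G)"
  have inj: "inj \<pi>" "inj (inv \<pi>)"
    using \<pi> bij_imp_bij_inv[OF \<pi>] by (auto simp: bij_is_inj)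
  have w: "?w c = Poly_Mapping.map_key \<pi> m \<longleftrightarrow> ?w (?h \<pi> c) = m" for c
  proof -
    have "Poly_Mapping.map_key \<pi> (?w (?h \<pi> c)) = ?w c"
      using map_key_sum_single[OF \<pi> assms, of c] by simp
    then show ?thesis by (metis map_key_inv(1)[OF \<pi>])
  qed
  have h: "?h \<tau> c \<in> proper_colorings G" if "c \<in> proper_colorings G" "inj \<tau>" for \<tau> c
    using that by (auto simp: proper_colorings_def inj_eq)
  have hh: "?h \<tau> (?h \<upsilon> c) = c"
    if "c \<in> proper_colorings G" "\<And>x. \<tau> (\<upsilon> x) = x" for \<tau> \<upsilon> c
    using that by (auto simp: proper_colorings_def PiE_def extensional_def fun_eq_iff)
  have i1: "inv \<pi> (\<pi> x) = x" and i2: "\<pi> (inv \<pi> x) = x" for x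
    using \<pi> by (simp_all add: bij_is_inj bij_is_surj surj_f_inv_f)
  have "bij_betw (?h \<pi>) {c \<in> proper_colorings G. ?w c = Poly_Mapping.map_key \<pi> m}
      {c \<in> proper_colorings G. ?w c = m}"
  proof (rule bij_betw_byWitness[where f' = "?h (inv \<pi>)"])
    show "\<forall>c\<in>{c \<in> proper_colorings G. ?w c = Poly_Mapping.map_key \<pi> m}. ?h (inv \<pi>) (?h \<pi> c) = c"
      using hh[of _ "inv \<pi>" \<pi>] i1 by blast
    show "\<forall>c\<in>{c \<in> proper_colorings G. ?w c = m}. ?h \<pi> (?h (inv \<pi>) c) = c"
      using hh[of _ \<pi> "inv \<pi>"] i2 by blast
    show "?h \<pi> ` {c \<in> proper_colorings G. ?w c = Poly_Mapping.map_key \<pi> m}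
        \<subseteq> {c \<in> proper_colorings G. ?w c = m}"
      using h[OF _ inj(1)] w by blast
    show "?h (inv \<pi>) ` {c \<in> proper_colorings G. ?w c = m}
        \<subseteq> {c \<in> proper_colorings G. ?w c = Poly_Mapping.map_key \<pi> m}"
    proof (rule image_subsetI)
      fix c assume "c \<in> {c \<in> proper_colorings G. ?w c = m}"
      then have c: "c \<in> proper_colorings G" "?w c = m" by auto
      have "?w (?h \<pi> (?h (inv \<pi>) c)) = m"
        unfolding hh[of c \<pi> "inv \<pi>", OF c(1) i2] by (rule c(2))
      then show "?h (inv \<pi>) c \<in> {c \<in> proper_colorings G. ?w c = Poly_Mapping.map_key \<pi> m}"
        using h[OF c(1) inj(2)] w[of "?h (inv \<pi>) c"] by blast
    qed
  qed
  then show "xcoeff (chromatic_sym G) (Poly_Mapping.map_key \<pi> m) = xcoeff (chromatic_sym G) m"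
    unfolding xcoeff_chromatic_sym[OF assms] by (simp only: bij_betw_same_card)
next
  fix m assume "card (fst G) < mdeg m"
  then have "{c \<in> proper_colorings G. (\<Sum>v\<in>fst G. Poly_Mapping.single (c v) 1) = m} = {}"
    using mdeg_sum_single[OF assms] by fastforce
  then show "xcoeff (chromatic_sym G) m = 0"
    unfolding xcoeff_chromatic_sym[OF assms] by (simp only: card.empty of_nat_0)
qed

subsection \<open>The homomorphism to symmetric functions\<close>

lemma xscale_simps:
  "xscale 0 f = 0" "xscale 1 f = f" "xscale (a + b) f = xscale a f + xscale b f"
  "xscale a (xscale b f) = xscale (a * b) f" "xscale a (f + g) = xscale a f + xscale a g"
  by (auto intro!: xseries_eqI simp: distrib_left distrib_right)

lemma xscale_mult: "xscale a f * xscale b g = xscale (a * b) (f * g)"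
  by (rule xseries_eqI)
    (simp add: times_xseries.rep_eq sum_distrib_left case_prod_unfold ac_simps)

abbreviation epow :: "composition \<Rightarrow> xseries" where
  "epow I \<equiv> prod_list (map esym (parts I))"

lemma rho_superset:
  assumes "finite K" "Poly_Mapping.keys f \<subseteq> K"
  shows "rho f = (\<Sum>I\<in>K. xscale (Poly_Mapping.lookup f I) (epow I))"
  unfolding rho_def
  by (rule sum.mono_neutral_left) (use assms in \<open>auto simp: in_keys_iff xscale_simps\<close>)

lemma rho_single: "rho (Poly_Mapping.single I a) = xscale a (epow I)"
  by (subst rho_superset[of "{I}"]) auto

lemma rho_0: "rho 0 = 0"
  by (simp add: rho_def)

lemma rho_add: "rho (f + g) = rho f + rho g"
proof -
  let ?K = "Poly_Mapping.keys f \<union> Poly_Mapping.keys g"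
  have "rho (f + g) = (\<Sum>I\<in>?K. xscale (Poly_Mapping.lookup (f + g) I) (epow I))"
    by (rule rho_superset) (auto simp: Poly_Mapping.keys_add)
  also have "\<dots> = rho f + rho g"
    by (simp add: lookup_add sum.distrib xscale_simps rho_superset[of ?K f] rho_superset[of ?K g])
  finally show ?thesis .
qed

lemma rho_sum: "rho (sum F A) = (\<Sum>i\<in>A. rho (F i))"
  by (induction A rule: infinite_finite_induct) (simp_all add: rho_0 rho_add)

lemma rho_nscale: "rho (c \<odot> f) = xscale c (rho f)"
proof -
  have "rho (c \<odot> f)
      = (\<Sum>I\<in>Poly_Mapping.keys f. xscale (Poly_Mapping.lookup (c \<odot> f) I) (epow I))"
    by (rule rho_superset) (auto simp: in_keys_iff)
  also have "\<dots> = (\<Sum>I\<in>Poly_Mapping.keys f. xscale c (xscale (Poly_Mapping.lookup f I) (epow I)))"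
    by (simp add: xscale_simps)
  also have "\<dots> = xscale c (\<Sum>I\<in>Poly_Mapping.keys f. xscale (Poly_Mapping.lookup f I) (epow I))"
  proof -
    have "finite A \<Longrightarrow> (\<Sum>I\<in>A. xscale c (F I)) = xscale c (sum F A)"
      for A :: "composition set" and F
      by (induction A rule: finite_induct) (auto simp: xscale_simps intro!: xseries_eqI)
    then show ?thesis by simp
  qed
  finally show ?thesis by (simp add: rho_def)
qed

lemma nsym_decomp:
  "f = (\<Sum>I\<in>Poly_Mapping.keys f. Poly_Mapping.single I (Poly_Mapping.lookup f I))"
  for f :: nsym
  by (rule poly_mapping_eqI)
    (simp add: lookup_sum lookup_single when_def sum.delta in_keys_iff)

lemma rho_mult: "rho (f * g) = rho f * rho g"
proof -
  let ?s = "\<lambda>f I. Poly_Mapping.single I (Poly_Mapping.lookup f I) :: nsym"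
  have "rho (f * g) = rho ((\<Sum>I\<in>Poly_Mapping.keys f. ?s f I) * (\<Sum>J\<in>Poly_Mapping.keys g. ?s g J))"
    by (simp flip: nsym_decomp)
  also have "\<dots> = (\<Sum>I\<in>Poly_Mapping.keys f. \<Sum>J\<in>Poly_Mapping.keys g. rho (?s f I) * rho (?s g J))"
    by (simp add: sum_product rho_sum mult_single rho_single xscale_mult)
  also have "\<dots> = rho f * rho g"
    unfolding rho_single sum_product[symmetric] by (simp only: rho_def)
  finally show ?thesis .
qed

lemma rho_1: "rho 1 = 1"
  using rho_single[of 0 1] by (simp add: xscale_simps)

lemma rho_Lam: "rho (Lam k) = esym k"
  by (cases "k = 0")
    (simp_all add: Lam_def rho_1 esym_0 rho_single xscale_simps Composition_inverse)

lemma rho_in_Sym: "rho f \<in> Sym"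
proof -
  have one: "1 \<in> Sym" using esym_in_Sym[of 0] by (simp add: esym_0)
  have "prod_list (map esym xs) \<in> Sym" for xs
    by (induction xs) (auto simp: one intro: Sym_mult esym_in_Sym)
  moreover have "finite A \<Longrightarrow> (\<And>I. F I \<in> Sym) \<Longrightarrow> sum F A \<in> Sym"
    for A :: "composition set" and F
    by (induction A rule: finite_induct) (auto intro: Sym_0 Sym_add)
  ultimately show ?thesis
    unfolding rho_def by (simp add: Sym_scale)
qed

end

theory Submission
  imports Defs
begin

text \<open>
  Write \<open>X(t)\<close> for the signed generating series \<open>\<Sum> (-1)\<^sup>n X\<^sub>n t\<^sup>n\<close>, where \<open>X\<^sub>n\<close> is the element
  attached to the path. Summing over compositions gives \<open>X(t) = 1 / (1 + t \<lambda>(-t) \<sigma>'(t))\<close>, and the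
  denominator equals both \<open>(L - t L') \<sigma>\<close> and \<open>L (\<sigma> + t \<sigma>')\<close> with \<open>L(t) = \<lambda>(-t)\<close>. The first form gives
  \<open>X = L / (L - t L')\<close> (the division on the right), hence the expansion in products of the \<open>\<Lambda>\<^sub>k\<close>. The
  second gives an expansion in products of the \<open>S\<^sub>k\<close>, whose coefficients count, with weight \<open>2\<close> for a
  part \<open>1\<close> and \<open>-1\<close> for a part \<open>2\<close>, the refinements that lie in \<open>C\<^sub>n\<close>; this is the ribbon expansion.

  For the commutative image, Newton's identities show that \<open>\<Psi>\<^sub>k\<close> becomes the power sum \<open>p\<^sub>k\<close>. It then
  remains to see that the chromatic functions satisfy \<open>X\<^sub>n = \<Sum> (-1)\<^sup>k\<^sup>-\<^sup>1 p\<^sub>k X\<^sub>n\<^sub>-\<^sub>k\<close>: the product \<open>p\<^sub>k X\<^sub>n\<^sub>-\<^sub>k\<close> splits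
  according to whether the repeated colour equals the first colour of the path, and the sum telescopes.
  The same telescoping proves Newton's identities.
\<close>

section \<open>Sums over compositions, handled on plain lists\<close>

definition clists :: "nat \<Rightarrow> nat list set" where
  "clists n = {xs. 0 \<notin> set xs \<and> sum_list xs = n}"

lemma bij_betw_parts: "bij_betw parts (compositions n) (clists n)"
proof (rule bij_betw_byWitness[where f' = Composition])
  show "Composition ` clists n \<subseteq> compositions n"
    by (auto simp: clists_def compositions_def Composition_inverse)
  show "parts ` compositions n \<subseteq> clists n"
    using parts by (auto simp: clists_def compositions_def)
qed (auto simp: parts_inverse Composition_inverse clists_def)

lemma finite_clists: "finite (clists n)"
  using bij_betw_finite[OF bij_betw_parts] finite_compositions by blast

lemma sum_compositions: "(\<Sum>I\<in>compositions n. f (parts I)) = sum f (clists n)"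
  by (rule sum.reindex_bij_betw[OF bij_betw_parts])

lemma clists_0: "clists 0 = {[]}"
proof -
  have "0 \<notin> set xs \<Longrightarrow> sum_list xs = 0 \<Longrightarrow> xs = []" for xs :: "nat list"
    by (cases xs) auto
  then show ?thesis by (auto simp: clists_def)
qed

text \<open>A nonempty composition is its first part \<open>k\<close> followed by a composition of
  \<open>n - k\<close>. All recursions over compositions below come from this splitting.\<close>

lemma sum_clists_Cons:
  assumes "0 < n"
  shows "sum f (clists n) = (\<Sum>k\<in>{1..n}. \<Sum>xs\<in>clists (n - k). f (k # xs))"
proof -
  have "(\<Sum>k\<in>{1..n}. \<Sum>xs\<in>clists (n - k). f (k # xs))
      = (\<Sum>(k, xs)\<in>(SIGMA k:{1..n}. clists (n - k)). f (k # xs))"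
    by (rule sum.Sigma) (auto simp: finite_clists)
  also have "\<dots> = sum f (clists n)"
  proof (rule sum.reindex_bij_witness[where j = "\<lambda>(k, xs). k # xs" and i = "\<lambda>xs. (hd xs, tl xs)"])
    fix xs assume "xs \<in> clists n"
    then show "(case (hd xs, tl xs) of (k, xs) \<Rightarrow> k # xs) = xs"
      and "(hd xs, tl xs) \<in> (SIGMA k:{1..n}. clists (n - k))"
      using assms by (cases xs; auto simp: clists_def)+
  qed (auto simp: clists_def)
  finally show ?thesis ..
qed

lemma sum_prod_clists_Cons:
  fixes F :: "nat \<Rightarrow> 'a :: semiring_1"
  assumes "0 < n"
  shows "(\<Sum>xs\<in>clists n. prod_list (map F xs))
    = (\<Sum>k\<in>{1..n}. F k * (\<Sum>xs\<in>clists (n - k). prod_list (map F xs)))"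
  by (simp add: sum_clists_Cons[OF assms] sum_distrib_left)

lemma left_inverse_eq_right_inverse:
  fixes a :: "'a :: monoid_mult"
  assumes "f * a = 1" "a * g = 1"
  shows "f = g"
proof -
  have "f = f * (a * g)" by (simp add: assms)
  also have "\<dots> = g" unfolding mult.assoc[symmetric] by (simp add: assms(1))
  finally show ?thesis .
qed

text \<open>Summing products over all compositions is the noncommutative geometric series, so
  splitting off the first part shows that \<open>C\<close> is a right inverse of
  \<open>\<Phi>\<close>.\<close>

lemma fps_csum_inverse:
  fixes F :: "nat \<Rightarrow> 'a :: ring_1"
  defines "C \<equiv> Abs_fps (\<lambda>n. \<Sum>xs\<in>clists n. prod_list (map F xs))"
    and "\<Phi> \<equiv> Abs_fps (\<lambda>n. if n = 0 then 1 else - F n)"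
  shows "\<Phi> * C = 1" "C * \<Phi> = 1"
proof -
  show *: "\<Phi> * C = 1"
  proof (rule fps_ext)
    fix n
    show "fps_nth (\<Phi> * C) n = fps_nth 1 n"
    proof (cases "n = 0")
      case False
      have "fps_nth (\<Phi> * C) n = fps_nth C n - (\<Sum>k\<in>{1..n}. F k * fps_nth C (n - k))"
        by (simp add: fps_mult_nth sum.atLeast_Suc_atMost[of 0] \<Phi>_def sum_negf)
      then show ?thesis
        using False sum_prod_clists_Cons[of n F] by (simp add: C_def)
    qed (simp add: \<Phi>_def C_def clists_0)
  qed
  \<comment> \<open>The constant term 1 also gives \<open>\<Phi>\<close> a left inverse, which must
    coincide with the right inverse \<open>C\<close>.\<close>
  have "fps_left_inverse \<Phi> 1 * \<Phi> = 1"
    by (rule fps_left_inverse) (simp add: \<Phi>_def)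
  then show "C * \<Phi> = 1"
    using * left_inverse_eq_right_inverse by blast
qed

section \<open>Scalars and signs in the free algebra\<close>

text \<open>Scaling is multiplication by a constant multiple of the empty monomial, and such
  constants are central.\<close>

lemma nscale_mult_left: "(c \<odot> f) * g = c \<odot> (f * g)"
  and nscale_mult_right: "f * (c \<odot> g) = c \<odot> (f * g)"
proof -
  have s: "c \<odot> f = Poly_Mapping.single 0 c * f" for f
  proof -
    have "c \<odot> f = (\<Sum>I\<in>Poly_Mapping.keys f. c \<odot> Poly_Mapping.single I (Poly_Mapping.lookup f I))"
      by (subst nsym_decomp[of f], rule poly_mapping_eqI) (simp add: lookup_sum sum_distrib_left)
    also have "\<dots> = Poly_Mapping.single 0 c * f"
    proof (subst (3) nsym_decomp[of f], unfold sum_distrib_left, rule sum.cong)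
      fix I
      show "c \<odot> Poly_Mapping.single I (Poly_Mapping.lookup f I) =
        Poly_Mapping.single 0 c * Poly_Mapping.single I (Poly_Mapping.lookup f I)"
        by (rule poly_mapping_eqI) (simp add: mult_single lookup_single when_def)
    qed simp
    finally show ?thesis .
  qed
  have t: "f * Poly_Mapping.single 0 c = Poly_Mapping.single 0 c * f" for f :: nsym
  proof -
    have "f * Poly_Mapping.single 0 c
      = (\<Sum>I\<in>Poly_Mapping.keys f. Poly_Mapping.single I (Poly_Mapping.lookup f I) * Poly_Mapping.single 0 c)"
      by (subst nsym_decomp[of f]) (simp add: sum_distrib_right)
    also have "\<dots> = (\<Sum>I\<in>Poly_Mapping.keys f. Poly_Mapping.single 0 c * Poly_Mapping.single I (Poly_Mapping.lookup f I))"
      by (simp add: mult_single mult.commute)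
    also have "\<dots> = Poly_Mapping.single 0 c * f"
      by (subst (3) nsym_decomp[of f]) (simp add: sum_distrib_left)
    finally show ?thesis .
  qed
  show "(c \<odot> f) * g = c \<odot> (f * g)"
    by (simp add: s mult.assoc)
  show "f * (c \<odot> g) = c \<odot> (f * g)"
    by (simp add: s t flip: mult.assoc)
qed

lemma nscale_add: "c \<odot> (f + g) = c \<odot> f + c \<odot> g"
  and nscale_add_left: "(a + b) \<odot> f = a \<odot> f + b \<odot> f"
  and nscale_0 [simp]: "0 \<odot> f = 0" "c \<odot> 0 = 0"
  and nscale_uminus: "(- c) \<odot> f = - (c \<odot> f)" "c \<odot> (- f) = - (c \<odot> f)"
  by (rule poly_mapping_eqI; simp add: lookup_add distrib_left distrib_right)+

lemma nscale_sum: "c \<odot> sum F A = (\<Sum>i\<in>A. c \<odot> F i)"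
  by (induction A rule: infinite_finite_induct) (simp_all add: nscale_add)

lemma sum_nscale: "(\<Sum>i\<in>A. f i \<odot> g) = sum f A \<odot> g"
  by (induction A rule: infinite_finite_induct) (simp_all add: nscale_add_left)

lemma of_nat_mult_nscale: "of_nat k * f = of_nat k \<odot> (f :: nsym)"
  by (induction k) (simp_all add: nscale_add_left distrib_right)

lemma prod_list_nscale:
  "prod_list (map (\<lambda>k. c k \<odot> F k) xs) = prod_list (map c xs) \<odot> prod_list (map F xs)"
  by (induction xs) (simp_all add: nscale_mult_left nscale_mult_right mult.commute)

lemma prod_list_sign:
  "prod_list (map (\<lambda>k. (- 1) ^ k * c k) xs) = (- 1) ^ sum_list xs * (prod_list (map c xs) :: rat)"
  by (induction xs) (simp_all add: power_add)

text \<open>The subtraction in \<open>eps\<close> is never truncated. Separating the two signs lets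
  the length be absorbed by negating each factor of a product.\<close>

lemma eps_conv: "eps I = (- 1) ^ sum_list (parts I) * (- 1) ^ clength I"
proof -
  obtain d where "sum_list (parts I) = clength I + d"
    using clength_le_sum[of I] le_Suc_ex by blast
  then show ?thesis by (simp add: eps_def power_add flip: power_mult_distrib)
qed

lemma prod_list_uminus:
  "prod_list (map (\<lambda>k. - F k) xs) = (- 1) ^ length xs \<odot> prod_list (map F xs)" for F :: "nat \<Rightarrow> nsym"
  using prod_list_nscale[of "\<lambda>_. - 1" F xs] by (simp add: nscale_uminus map_replicate_const)

section \<open>The generating series of the path elements\<close>

abbreviation lam_neg :: "nsym fps" where
  "lam_neg \<equiv> lam_gf oo (- fps_X)"

lemma lam_neg_nth: "fps_nth lam_neg n = (- 1) ^ n \<odot> Lam n"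
proof -
  have "fps_nth ((- fps_X) ^ i) n = (if i = n then (- 1) ^ n else 0 :: nsym)" for i
    by (cases "even i") (auto simp: minus_one_power_iff)
  then have "fps_nth lam_neg n = Lam n * (- 1) ^ n"
    by (simp add: fps_compose_nth lam_gf_def if_distrib[of "(*) _"] cong: if_cong)
  then show ?thesis
    by (cases "even n") (simp_all add: nscale_uminus)
qed

text \<open>Leibniz rule applied to \<open>lam_neg * sigma_gf = 1\<close>, with the order of the
  factors kept.\<close>

lemma lam_neg_deriv: "lam_neg * fps_deriv sigma_gf = - (fps_deriv lam_neg * sigma_gf)"
proof -
  have "lam_neg * fps_deriv sigma_gf + fps_deriv lam_neg * sigma_gf = 0"
    using arg_cong[OF sigma_gf_inverse(1), of fps_deriv] by simp
  then show ?thesis by (simp add: add_eq_0_iff2)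
qed

text \<open>The minus on each \<open>Psi k\<close> supplies the length part of \<open>eps\<close>;
  the degree part is the substitution of -t for t.\<close>

definition X_neg :: "nsym fps" where
  "X_neg = Abs_fps (\<lambda>n. \<Sum>xs\<in>clists n. prod_list (map (\<lambda>k. - Psi k) xs))"

lemma Xtilde_conv: "Xtilde n = (- 1) ^ n \<odot> fps_nth X_neg n"
proof -
  have "Xtilde n = (\<Sum>I\<in>compositions n. (- 1) ^ n \<odot> prod_list (map (\<lambda>k. - Psi k) (parts I)))"
    unfolding Xtilde_def
    by (rule sum.cong) (auto simp: prod_list_uminus eps_conv npow_def compositions_def)
  also have "\<dots> = (- 1) ^ n \<odot> fps_nth X_neg n"
    by (subst sum_compositions) (simp add: X_neg_def nscale_sum)
  finally show ?thesis .
qed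

text \<open>Multiplication by t undoes the index shift in \<open>Psi\<close>, so the factor is 1
  plus the series of the \<open>Psi n\<close>, and \<open>X_neg\<close> is the matching geometric
  series.\<close>

lemma X_neg_inverse:
  "(1 + fps_X * (lam_neg * fps_deriv sigma_gf)) * X_neg = 1"
  "X_neg * (1 + fps_X * (lam_neg * fps_deriv sigma_gf)) = 1"
proof -
  have "1 + fps_X * (lam_neg * fps_deriv sigma_gf)
      = Abs_fps (\<lambda>n. if n = 0 then 1 else - (- Psi n))"
    by (rule fps_ext) (simp add: Psi_def)
  then show "(1 + fps_X * (lam_neg * fps_deriv sigma_gf)) * X_neg = 1"
    and "X_neg * (1 + fps_X * (lam_neg * fps_deriv sigma_gf)) = 1"
    using fps_csum_inverse[of "\<lambda>k. - Psi k"] by (simp_all only: X_neg_def)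
qed

lemma X_neg_eqI:
  assumes "f * (1 + fps_X * (lam_neg * fps_deriv sigma_gf)) = 1"
  shows "f = X_neg"
  by (rule left_inverse_eq_right_inverse[OF assms X_neg_inverse(1)])

text \<open>Replace 1 by \<open>lam_neg * sigma_gf\<close> and use that t is central. This form
  leads to products of the \<open>Sn k\<close>, the next one to products of the
  \<open>Lam k\<close>.\<close>

lemma Psi_gf_left:
  "1 + fps_X * (lam_neg * fps_deriv sigma_gf) = lam_neg * (sigma_gf + fps_X * fps_deriv sigma_gf)"
proof -
  have "fps_X * (lam_neg * fps_deriv sigma_gf) = lam_neg * (fps_X * fps_deriv sigma_gf)"
    by (simp only: fps_mult_fps_X_commute[of lam_neg] flip: mult.assoc)
  then show ?thesis by (simp add: distrib_left sigma_gf_inverse)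
qed

lemma Psi_gf_right:
  "1 + fps_X * (lam_neg * fps_deriv sigma_gf) = (lam_neg - fps_X * fps_deriv lam_neg) * sigma_gf"
  by (simp add: left_diff_distrib sigma_gf_inverse lam_neg_deriv mult.assoc)

subsection \<open>Expansion in the elementary basis\<close>

text \<open>\<open>X_neg\<close> is \<open>lam_neg * D\<close>, where \<open>D\<close> inverts L - t
  L' and gives each part k the weight k - 1. The extra left factor raises the weight of the first
  part to k.\<close>

lemma Xtilde_Lam:
  assumes "n \<ge> 1"
  shows "Xtilde n = (\<Sum>I\<in>compositions n.
      (of_nat (hd (parts I)) * (\<Prod>i\<leftarrow>tl (parts I). of_nat i - 1)) \<odot> npow Lam I)"
proof -
  define F where "F k = ((- 1) ^ k * (of_nat k - 1)) \<odot> Lam k" for k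
  define D where "D = Abs_fps (\<lambda>n. \<Sum>xs\<in>clists n. prod_list (map F xs))"
  have "lam_neg - fps_X * fps_deriv lam_neg = Abs_fps (\<lambda>n. if n = 0 then 1 else - F n)"
  proof (rule fps_ext)
    fix n
    show "fps_nth (lam_neg - fps_X * fps_deriv lam_neg) n
      = fps_nth (Abs_fps (\<lambda>n. if n = 0 then 1 else - F n)) n"
    proof (cases n)
      case (Suc k)
      have "fps_nth (lam_neg - fps_X * fps_deriv lam_neg) n
          = (- 1) ^ n \<odot> Lam n - of_nat n * ((- 1) ^ n \<odot> Lam n)"
        unfolding lam_neg_nth[symmetric] by (simp add: Suc)
      also have "\<dots> = - F n"
        unfolding of_nat_mult_nscale F_def
        by (rule poly_mapping_eqI) (simp add: lookup_minus algebra_simps)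
      finally show ?thesis by (simp add: Suc)
    qed (simp add: lam_gf_def Lam_def)
  qed
  then have D: "D * (lam_neg - fps_X * fps_deriv lam_neg) = 1"
    using fps_csum_inverse(2)[of F] by (simp add: D_def)
  have "lam_neg * D = X_neg"
  proof (rule X_neg_eqI)
    have "lam_neg * D * (1 + fps_X * (lam_neg * fps_deriv sigma_gf))
        = lam_neg * (D * (lam_neg - fps_X * fps_deriv lam_neg)) * sigma_gf"
      unfolding Psi_gf_right by (simp only: mult.assoc)
    then show "lam_neg * D * (1 + fps_X * (lam_neg * fps_deriv sigma_gf)) = 1"
      by (simp add: D sigma_gf_inverse)
  qed
  then have "fps_nth X_neg n = fps_nth (lam_neg * D) n" by simp
  also have "\<dots> = fps_nth D n + (\<Sum>k\<in>{1..n}. fps_nth lam_neg k * fps_nth D (n - k))"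
    by (simp add: fps_mult_nth sum.atLeast_Suc_atMost[of 0] lam_gf_def Lam_def)
  \<comment> \<open>Expanding \<open>D\<close> by its first part brings both summands to the same
    shape; the weights k - 1 and 1 then add up to k.\<close>
  also have "fps_nth D n = (\<Sum>k\<in>{1..n}. F k * fps_nth D (n - k))"
    unfolding D_def using sum_prod_clists_Cons[of n F] assms by simp
  also have "(\<Sum>k\<in>{1..n}. F k * fps_nth D (n - k)) + (\<Sum>k\<in>{1..n}. fps_nth lam_neg k * fps_nth D (n - k))
      = (\<Sum>k\<in>{1..n}. (((- 1) ^ k * of_nat k) \<odot> Lam k) * fps_nth D (n - k))"
    unfolding sum.distrib[symmetric] distrib_right[symmetric] lam_neg_nth F_def
      nscale_add_left[symmetric]
    by (simp add: right_diff_distrib)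
  also have "\<dots> = (\<Sum>k\<in>{1..n}. \<Sum>xs\<in>clists (n - k).
      (- 1) ^ n \<odot> (of_nat k * (\<Prod>i\<leftarrow>xs. of_nat i - 1)) \<odot> prod_list (map Lam (k # xs)))"
  proof (intro sum.cong refl)
    fix k assume k: "k \<in> {1..n}"
    have "prod_list (map F xs) = ((- 1) ^ (n - k) * (\<Prod>i\<leftarrow>xs. of_nat i - 1)) \<odot> prod_list (map Lam xs)"
      if "xs \<in> clists (n - k)" for xs
      using that unfolding F_def prod_list_nscale prod_list_sign by (simp add: clists_def)
    moreover have "(- 1) ^ n = (- 1) ^ k * (- 1 :: rat) ^ (n - k)"
      using k by (simp flip: power_add)
    ultimately show "(((- 1) ^ k * of_nat k) \<odot> Lam k) * fps_nth D (n - k) = (\<Sum>xs\<in>clists (n - k).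
      (- 1) ^ n \<odot> (of_nat k * (\<Prod>i\<leftarrow>xs. of_nat i - 1)) \<odot> prod_list (map Lam (k # xs)))"
      by (simp add: D_def sum_distrib_left nscale_mult_left nscale_mult_right mult_ac)
  qed
  also have "\<dots> = (- 1) ^ n \<odot> (\<Sum>xs\<in>clists n. (of_nat (hd xs) * (\<Prod>i\<leftarrow>tl xs. of_nat i - 1))
      \<odot> prod_list (map Lam xs))"
    using assms by (subst sum_clists_Cons) (simp_all add: nscale_sum)
  finally have "Xtilde n = (\<Sum>xs\<in>clists n. (of_nat (hd xs) * (\<Prod>i\<leftarrow>tl xs. of_nat i - 1))
      \<odot> prod_list (map Lam xs))"
    by (simp add: Xtilde_conv flip: power_mult_distrib)
  also have "\<dots> = (\<Sum>I\<in>compositions n.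
      (of_nat (hd (parts I)) * (\<Prod>i\<leftarrow>tl (parts I). of_nat i - 1)) \<odot> npow Lam I)"
    unfolding npow_def by (rule sum_compositions[symmetric])
  finally show ?thesis .
qed

subsection \<open>Expansion in the ribbon basis\<close>

text \<open>Twice the coefficient of \<open>S\<^sup>J\<close> up to sign. The factors \<open>j + 1\<close> come from \<open>\<sigma> + t \<sigma>'\<close>.\<close>

fun ribbon_wt :: "nat list \<Rightarrow> rat" where
  "ribbon_wt [] = 0"
| "ribbon_wt [j] = 2 * of_nat j"
| "ribbon_wt (j # k # js) = (of_nat j + 1) * ribbon_wt (k # js)"

lemma ribbon_wt_Cons:
  "ribbon_wt (j # js) = (if js = [] then 2 * of_nat j else (of_nat j + 1) * ribbon_wt js)"
  by (cases js) auto

text \<open>With A = \<sigma> + t \<sigma>', the left form gives A \<open>X_neg\<close> = \<sigma>,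
  so V = 2 \<open>X_neg\<close> - 2 is the solution of A V = - 2 t \<sigma>'. The coefficients k + 1
  of A weight the parts before the last, the right-hand side weights the last part.\<close>

lemma X_neg_Sn:
  assumes "n \<ge> 1"
  shows "2 \<odot> fps_nth X_neg n
    = (\<Sum>xs\<in>clists n. ((- 1) ^ length xs * ribbon_wt xs) \<odot> prod_list (map Sn xs))"
proof -
  define V where "V = Abs_fps (\<lambda>n. \<Sum>xs\<in>clists n.
    ((- 1) ^ length xs * ribbon_wt xs) \<odot> prod_list (map Sn xs))"
  let ?A = "sigma_gf + fps_X * fps_deriv sigma_gf"
  have S0: "Sn 0 = 1"
    by (simp add: Sn_def sigma_gf_def)
  have V0: "fps_nth V 0 = 0"
    by (simp add: V_def clists_0)
  have sd: "fps_nth (fps_X * fps_deriv sigma_gf) n = of_nat n \<odot> Sn n" for n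
    unfolding of_nat_mult_nscale[symmetric] by (cases n) (simp_all add: Sn_def)
  have A: "fps_nth ?A n = (of_nat n + 1) \<odot> Sn n" for n
    unfolding fps_add_nth sd by (simp add: nscale_add_left Sn_def add.commute)
  have V: "fps_nth V n = - ((2 * of_nat n) \<odot> Sn n)
      - (\<Sum>k\<in>{1..n}. ((of_nat k + 1) \<odot> Sn k) * fps_nth V (n - k))" if "n > 0" for n
  proof -
    have "fps_nth V n = (\<Sum>k\<in>{1..n}. \<Sum>xs\<in>clists (n - k).
        ((- 1) ^ length (k # xs) * ribbon_wt (k # xs)) \<odot> prod_list (map Sn (k # xs)))"
      unfolding V_def fps_nth_Abs_fps by (rule sum_clists_Cons[OF that])
    also have "\<dots> = (\<Sum>k\<in>{1..n}. (if k = n then - ((2 * of_nat n) \<odot> Sn n) else 0)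
        - ((of_nat k + 1) \<odot> Sn k) * fps_nth V (n - k))"
    proof (rule sum.cong)
      fix k assume k: "k \<in> {1..n}"
      show "(\<Sum>xs\<in>clists (n - k).
          ((- 1) ^ length (k # xs) * ribbon_wt (k # xs)) \<odot> prod_list (map Sn (k # xs)))
        = (if k = n then - ((2 * of_nat n) \<odot> Sn n) else 0)
          - ((of_nat k + 1) \<odot> Sn k) * fps_nth V (n - k)"
      \<comment> \<open>The case \<open>k = n\<close> is the composition with a single part: there
        \<open>V\<close> contributes its constant term 0 and the base value of
        \<open>ribbon_wt\<close> enters.\<close>
      proof (cases "k = n")
        case False
        have "((- 1) ^ length (k # xs) * ribbon_wt (k # xs)) \<odot> prod_list (map Sn (k # xs))
          = - (((of_nat k + 1) \<odot> Sn k) * (((- 1) ^ length xs * ribbon_wt xs) \<odot> prod_list (map Sn xs)))"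
          if "xs \<in> clists (n - k)" for xs
        proof -
          have "xs \<noteq> []" using that False k by (auto simp: clists_def)
          then show ?thesis
            by (simp add: ribbon_wt_Cons nscale_mult_left nscale_mult_right nscale_uminus mult_ac)
        qed
        then show ?thesis
          using False by (simp add: V_def sum_distrib_left sum_negf)
      qed (simp add: V0 clists_0 nscale_uminus)
    qed simp
    also have "\<dots> = - ((2 * of_nat n) \<odot> Sn n)
      - (\<Sum>k\<in>{1..n}. ((of_nat k + 1) \<odot> Sn k) * fps_nth V (n - k))"
      using that by (simp add: sum_subtractf)
    finally show ?thesis .
  qed
  have "?A * V = - (2 * (fps_X * fps_deriv sigma_gf))"
  proof (rule fps_ext)
    fix n
    show "fps_nth (?A * V) n = fps_nth (- (2 * (fps_X * fps_deriv sigma_gf))) n"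
    proof (cases "n = 0")
      case False
      have "fps_nth (?A * V) n = fps_nth V n + (\<Sum>k\<in>{1..n}. ((of_nat k + 1) \<odot> Sn k) * fps_nth V (n - k))"
        unfolding fps_mult_nth A by (simp add: sum.atLeast_Suc_atMost[of 0] S0)
      also have "\<dots> = - ((2 * of_nat n) \<odot> Sn n)"
        using V[of n] False by simp
      also have "\<dots> = fps_nth (- (2 * (fps_X * fps_deriv sigma_gf))) n"
        unfolding mult_2 fps_neg_nth fps_add_nth sd by (simp flip: nscale_add_left)
      finally show ?thesis .
    qed (simp add: V0)
  qed
  \<comment> \<open>Adding 2 A cancels the derivative term; the 2 restores the constant term of the
    doubled series.\<close>
  then have "?A * (V + 2) = 2 * sigma_gf"
    by (simp add: distrib_left distrib_right mult_2 mult_2_right)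
  then have "(1 + fps_X * (lam_neg * fps_deriv sigma_gf)) * (V + 2) = 2"
    unfolding Psi_gf_left mult.assoc
    by (simp add: sigma_gf_inverse distrib_left mult_2)
  then have "X_neg * (1 + fps_X * (lam_neg * fps_deriv sigma_gf)) * (V + 2) = X_neg * 2"
    by (simp only: mult.assoc)
  then have "V + 2 = X_neg * 2"
    by (simp only: X_neg_inverse mult_1_left)
  then have "fps_nth (V + 2) n = fps_nth (X_neg + X_neg) n"
    by (simp add: mult_2_right)
  then have "fps_nth V n = fps_nth X_neg n + fps_nth X_neg n"
    using assms by (simp add: fps_numeral_nth)
  also have "\<dots> = 2 \<odot> fps_nth X_neg n"
    using nscale_add_left[of 1 1 "fps_nth X_neg n"] by simp
  finally show ?thesis by (simp add: V_def)
qed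

section \<open>Weighted counts of refinements with parts 1 and 2\<close>

definition refinements :: "nat list \<Rightarrow> nat list set" where
  "refinements js = {xs. 0 \<notin> set xs \<and> (\<exists>Ks. concat Ks = xs \<and> map sum_list Ks = js)}"

lemma refinements_Nil: "refinements [] = {[]}"
  by (auto simp: refinements_def)

text \<open>One of the two prefixes extends the other, and positive parts with equal sums leave no
  room for a proper extension.\<close>

lemma append_clists_inj:
  assumes "ys @ zs = ys' @ zs'" "ys \<in> clists j" "ys' \<in> clists j"
  shows "ys = ys' \<and> zs = zs'"
  using assms unfolding clists_def
proof (induction ys arbitrary: ys' j)
  case Nil
  then show ?case by (cases ys') auto
next
  case (Cons y ys)
  then show ?case by (cases ys') auto
qed

text \<open>The block refining \<open>j\<close> can be read off from the concatenation, by
  \<open>append_clists_inj\<close>.\<close>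

lemma sum_refinements_Cons:
  "sum f (refinements (j # js)) = (\<Sum>ys\<in>clists j. \<Sum>zs\<in>refinements js. f (ys @ zs))"
proof -
  have "bij_betw (\<lambda>(ys, zs). ys @ zs) (clists j \<times> refinements js) (refinements (j # js))"
  proof (rule bij_betwI')
    fix p q assume "p \<in> clists j \<times> refinements js" "q \<in> clists j \<times> refinements js"
    then show "(case p of (ys, zs) \<Rightarrow> ys @ zs) = (case q of (ys, zs) \<Rightarrow> ys @ zs) \<longleftrightarrow> p = q"
      using append_clists_inj[of "fst p" "snd p" "fst q" "snd q" j] by (auto simp: prod_eq_iff)
  next
    fix p assume "p \<in> clists j \<times> refinements js"
    then obtain ys Ks where p: "p = (ys, concat Ks)" "ys \<in> clists j" "0 \<notin> set (concat Ks)"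
      "map sum_list Ks = js"
      by (auto simp: refinements_def)
    then have "\<exists>Ls. concat Ls = ys @ concat Ks \<and> map sum_list Ls = j # js"
      by (intro exI[of _ "ys # Ks"]) (simp add: clists_def)
    then show "(case p of (ys, zs) \<Rightarrow> ys @ zs) \<in> refinements (j # js)"
      using p by (simp add: refinements_def clists_def)
  next
    fix xs assume "xs \<in> refinements (j # js)"
    then obtain K Ks where "xs = K @ concat Ks" "0 \<notin> set xs" "sum_list K = j" "map sum_list Ks = js"
      by (auto simp: refinements_def map_eq_Cons_conv)
    then show "\<exists>p\<in>clists j \<times> refinements js. xs = (case p of (ys, zs) \<Rightarrow> ys @ zs)"
      by (intro bexI[of _ "(K, concat Ks)"]) (auto simp: clists_def refinements_def)
  qed
  then have "sum f (refinements (j # js))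
      = (\<Sum>p\<in>clists j \<times> refinements js. f (case p of (ys, zs) \<Rightarrow> ys @ zs))"
    by (rule sum.reindex_bij_betw[symmetric])
  then show ?thesis
    by (simp add: sum.cartesian_product case_prod_unfold)
qed

text \<open>The contribution of one part to \<open>2 ^ m1 I * eps I\<close>; the value 0 removes
  compositions with parts other than 1 and 2.\<close>

definition part_wt :: "nat \<Rightarrow> rat" where
  "part_wt k = (if k = 1 then 2 else if k = 2 then - 1 else 0)"

text \<open>Agrees with \<open>2 ^ m1 I * eps I\<close> on members of \<open>C12\<close> and
  vanishes elsewhere, so sums over \<open>C12\<close> can be extended to all refinements.\<close>

definition C12_wt :: "nat list \<Rightarrow> rat" where
  "C12_wt xs = (if xs \<noteq> [] \<and> last xs = 1 then prod_list (map part_wt xs) else 0)"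

lemma prod_list_part_wt:
  "prod_list (map part_wt xs) = (if set xs \<subseteq> {1, 2}
    then 2 ^ count_list xs 1 * ((- 1) ^ sum_list xs * (- 1) ^ length xs) else 0)"
  by (induction xs) (auto simp: part_wt_def)

lemma sum_clists_front12:
  fixes f :: "nat list \<Rightarrow> rat"
  assumes "\<And>k xs. k \<noteq> 1 \<Longrightarrow> k \<noteq> 2 \<Longrightarrow> f (k # xs) = 0" "j \<ge> 2"
  shows "sum f (clists j) = (\<Sum>xs\<in>clists (j - 1). f (1 # xs)) + (\<Sum>xs\<in>clists (j - 2). f (2 # xs))"
proof -
  have "sum f (clists j) = (\<Sum>k\<in>{1..j}. \<Sum>xs\<in>clists (j - k). f (k # xs))"
    using assms(2) by (intro sum_clists_Cons) simp
  also have "\<dots> = (\<Sum>k\<in>{1, 2}. \<Sum>xs\<in>clists (j - k). f (k # xs))"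
    by (rule sum.mono_neutral_right) (use assms in auto)
  finally show ?thesis by simp
qed

lemma clists_1: "sum f (clists 1) = f [1]"
  by (simp add: sum_clists_Cons clists_0)

text \<open>Splitting off the first part gives a(j) = 2 a(j-1) - a(j-2) with a(0) = 1 and a(1) = 2;
  the generating function is 1/(1-t)^2.\<close>

lemma sum_part_wt: "(\<Sum>xs\<in>clists j. prod_list (map part_wt xs)) = of_nat j + 1"
proof (induction j rule: less_induct)
  case (less j)
  consider "j = 0" | "j = 1" | "j \<ge> 2" by linarith
  then show ?case
  proof cases
    case 3
    then have "(\<Sum>xs\<in>clists j. prod_list (map part_wt xs))
        = 2 * (of_nat (j - 1) + 1) - (of_nat (j - 2) + 1)"
      by (subst sum_clists_front12)
        (simp_all add: part_wt_def less sum_negf flip: sum_distrib_left)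
    then show ?thesis using 3 by (simp add: of_nat_diff)
  qed (simp_all add: clists_0 clists_1[unfolded One_nat_def] part_wt_def)
qed

text \<open>The recurrence of \<open>sum_part_wt\<close> persists, but the condition on the last
  part changes the value at 0 to 0.\<close>

lemma sum_C12_wt: "sum C12_wt (clists j) = 2 * of_nat j"
proof (induction j rule: less_induct)
  case (less j)
  consider "j = 0" | "j = 1" | "j \<ge> 2" by linarith
  then show ?case
  proof cases
    case 3
    \<comment> \<open>This fails for empty \<open>xs\<close>, where the new 1 is itself the last
      part; \<open>j \<ge> 2\<close> excludes that.\<close>
    have "C12_wt (1 # xs) = 2 * C12_wt xs" if "xs \<in> clists (j - 1)" for xs
    proof -
      have "xs \<noteq> []" using that 3 by (auto simp: clists_def)
      then show ?thesis by (simp add: C12_wt_def part_wt_def)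
    qed
    \<comment> \<open>For empty \<open>xs\<close> both sides vanish, because the last part of
      \<open>[2]\<close> is not 1.\<close>
    moreover have "C12_wt (2 # xs) = - C12_wt xs" for xs
      by (simp add: C12_wt_def part_wt_def)
    ultimately have "sum C12_wt (clists j) = 2 * (2 * of_nat (j - 1)) - 2 * of_nat (j - 2)"
      using 3 by (subst sum_clists_front12)
        (auto simp add: less sum_negf simp flip: sum_distrib_left, auto simp: C12_wt_def part_wt_def)
    then show ?thesis using 3 by (simp add: of_nat_diff)
  qed (use clists_1[of C12_wt] in \<open>simp_all add: clists_0 C12_wt_def part_wt_def del: One_nat_def\<close>)
qed

text \<open>The weight is multiplicative over blocks and only the last block carries the condition
  on the last part. It contributes 2j, every earlier block j + 1.\<close>

lemma sum_refinements_C12_wt: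
  "0 \<notin> set js \<Longrightarrow> js \<noteq> [] \<Longrightarrow> sum C12_wt (refinements js) = ribbon_wt js"
proof (induction js rule: ribbon_wt.induct)
  case (2 j)
  then show ?case by (simp add: sum_refinements_Cons refinements_Nil sum_C12_wt)
next
  case (3 j k js)
  have "C12_wt (ys @ zs) = prod_list (map part_wt ys) * C12_wt zs"
    if "zs \<in> refinements (k # js)" for ys zs
  proof -
    have "zs \<noteq> []"
      using that 3 by (auto simp: refinements_def Cons_eq_map_conv)
    then show ?thesis by (simp add: C12_wt_def)
  qed
  then have "sum C12_wt (refinements (j # k # js))
      = (\<Sum>ys\<in>clists j. \<Sum>zs\<in>refinements (k # js). prod_list (map part_wt ys) * C12_wt zs)"
    unfolding sum_refinements_Cons[of _ j] by (intro sum.cong) auto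
  also have "\<dots> = (of_nat j + 1) * sum C12_wt (refinements (k # js))"
    by (simp add: sum_part_wt flip: sum_product)
  finally show ?case using 3 by simp
qed simp

lemma sum_C12_coarser:
  assumes "J \<in> compositions n" "n \<ge> 1"
  shows "(\<Sum>I | I \<in> C12 n \<and> J \<preceq> I. 2 ^ m1 I * eps I) = ribbon_wt (parts J)"
proof -
  have J: "0 \<notin> set (parts J)" "parts J \<noteq> []"
    using parts[of J] assms by (auto simp: compositions_def)
  have bij: "bij_betw parts {I. J \<preceq> I} (refinements (parts J))"
    by (rule bij_betw_byWitness[where f' = Composition])
      (use parts in \<open>auto simp: refinements_def coarser_def parts_inverse Composition_inverse\<close>)
  have sum: "J \<preceq> I \<Longrightarrow> I \<in> compositions n" for I
    using coarser_compositions[of J I "sum_list (parts I)"] assms(1) by (auto simp: compositions_def)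
  have "(\<Sum>I | I \<in> C12 n \<and> J \<preceq> I. 2 ^ m1 I * eps I) = (\<Sum>I | I \<in> C12 n \<and> J \<preceq> I. C12_wt (parts I))"
    by (rule sum.cong) (auto simp: C12_def C12_wt_def prod_list_part_wt m1_def eps_conv)
  also have "\<dots> = (\<Sum>I | J \<preceq> I. C12_wt (parts I))"
  proof (rule sum.mono_neutral_left)
    show "finite {I. J \<preceq> I}"
      using sum by (intro finite_subset[OF _ finite_compositions[of n]]) auto
    show "\<forall>I\<in>{I. J \<preceq> I} - {I. I \<in> C12 n \<and> J \<preceq> I}. C12_wt (parts I) = 0"
      using sum by (auto simp: C12_def C12_wt_def prod_list_part_wt)
  qed auto
  also have "\<dots> = sum C12_wt (refinements (parts J))"
    by (rule sum.reindex_bij_betw[OF bij])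
  also have "\<dots> = ribbon_wt (parts J)"
    by (rule sum_refinements_C12_wt[OF J])
  finally show ?thesis .
qed

text \<open>Expand the ribbons in products of the \<open>Sn k\<close> and exchange the sums. The
  coefficient at \<open>J\<close> becomes a signed count of the members of \<open>C12\<close> finer
  than \<open>J\<close>, which matches \<open>X_neg_Sn\<close>.\<close>

lemma Xtilde_ribbon:
  assumes "n \<ge> 1"
  shows "Xtilde n = (1 / 2) \<odot> (\<Sum>I\<in>C12 n. 2 ^ m1 I \<odot> ribbon I)"
proof -
  have fin: "finite (C12 n)"
    by (rule finite_subset[OF _ finite_compositions[of n]]) (auto simp: C12_def)
  have "(\<Sum>I\<in>C12 n. 2 ^ m1 I \<odot> ribbon I)
      = (\<Sum>I\<in>C12 n. \<Sum>J | J \<in> compositions n \<and> J \<preceq> I. (2 ^ m1 I * eps I * eps J) \<odot> npow Sn J)"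
  proof (rule sum.cong)
    fix I assume "I \<in> C12 n"
    then have "{J. J \<preceq> I} = {J. J \<in> compositions n \<and> J \<preceq> I}"
      using coarser_compositions by (auto simp: C12_def)
    then show "2 ^ m1 I \<odot> ribbon I
        = (\<Sum>J | J \<in> compositions n \<and> J \<preceq> I. (2 ^ m1 I * eps I * eps J) \<odot> npow Sn J)"
      by (simp add: ribbon_def nscale_sum mult.assoc)
  qed simp
  also have "\<dots> = (\<Sum>J\<in>compositions n. \<Sum>I | I \<in> C12 n \<and> J \<preceq> I. (2 ^ m1 I * eps I * eps J) \<odot> npow Sn J)"
    by (rule sum.swap_restrict[OF fin finite_compositions])
  also have "\<dots> = (\<Sum>J\<in>compositions n. (- 1) ^ n \<odot>
      (((- 1) ^ clength J * ribbon_wt (parts J)) \<odot> prod_list (map Sn (parts J))))"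
  proof (rule sum.cong)
    fix J assume J: "J \<in> compositions n"
    have "(\<Sum>I | I \<in> C12 n \<and> J \<preceq> I. (2 ^ m1 I * eps I * eps J) \<odot> npow Sn J)
        = (ribbon_wt (parts J) * eps J) \<odot> npow Sn J"
      unfolding sum_nscale sum_distrib_right[symmetric] sum_C12_coarser[OF J assms] ..
    then show "(\<Sum>I | I \<in> C12 n \<and> J \<preceq> I. (2 ^ m1 I * eps I * eps J) \<odot> npow Sn J)
        = (- 1) ^ n \<odot> (((- 1) ^ clength J * ribbon_wt (parts J)) \<odot> prod_list (map Sn (parts J)))"
      using J by (simp add: eps_conv npow_def compositions_def mult_ac)
  qed simp
  also have "\<dots> = (- 1) ^ n \<odot> 2 \<odot> fps_nth X_neg n"
    unfolding X_neg_Sn[OF assms] nscale_sum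
    by (rule sum_compositions)
  also have "\<dots> = 2 \<odot> Xtilde n"
    by (simp add: Xtilde_conv mult.commute)
  finally show ?thesis by simp
qed

subsection \<open>Counting series\<close>

text \<open>The sum of the monomials with exponents \<open>w s\<close> for \<open>s\<close> in
  \<open>S\<close>. It is meaningful for locally finite families, as \<open>card\<close> is 0 on
  infinite sets.\<close>

definition cser :: "'s set \<Rightarrow> ('s \<Rightarrow> (pos \<Rightarrow>\<^sub>0 nat)) \<Rightarrow> xseries" where
  "cser S w = Xseries (\<lambda>m. of_nat (card {s \<in> S. w s = m}))"

definition locally_finite :: "'s set \<Rightarrow> ('s \<Rightarrow> (pos \<Rightarrow>\<^sub>0 nat)) \<Rightarrow> bool" where
  "locally_finite S w \<longleftrightarrow> (\<forall>m. finite {s \<in> S. w s = m})"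

lemma xcoeff_cser: "xcoeff (cser S w) m = of_nat (card {s \<in> S. w s = m})"
  by (simp add: cser_def Xseries_inverse)

lemma cser_empty: "cser {} w = 0"
  by (rule xseries_eqI) (simp add: xcoeff_cser)

lemma cser_bij_betw:
  assumes "bij_betw h S T" "\<And>s. s \<in> S \<Longrightarrow> v (h s) = w s"
  shows "cser S w = cser T v"
proof (rule xseries_eqI)
  fix m
  have "bij_betw h {s \<in> S. w s = m} {t \<in> T. v t = m}"
    using assms unfolding bij_betw_def inj_on_def by auto
  then show "xcoeff (cser S w) m = xcoeff (cser T v) m"
    by (simp add: xcoeff_cser bij_betw_same_card)
qed

lemma locally_finite_subset:
  assumes "locally_finite T w" "S \<subseteq> T"
  shows "locally_finite S w"
  unfolding locally_finite_def
proof
  fix m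
  have "finite {s \<in> T. w s = m}" using assms(1) by (simp add: locally_finite_def)
  then show "finite {s \<in> S. w s = m}" by (rule rev_finite_subset) (use assms(2) in auto)
qed

lemma cser_Un:
  assumes "locally_finite (S \<union> T) w" "S \<inter> T = {}"
  shows "cser (S \<union> T) w = cser S w + cser T w"
proof (rule xseries_eqI)
  fix m
  have "{s \<in> S \<union> T. w s = m} = {s \<in> S. w s = m} \<union> {s \<in> T. w s = m}" by auto
  moreover have "finite {s \<in> S. w s = m}" "finite {s \<in> T. w s = m}"
    using locally_finite_subset[OF assms(1)] unfolding locally_finite_def by auto
  ultimately show "xcoeff (cser (S \<union> T) w) m = xcoeff (cser S w + cser T w) m"
    using assms(2) by (simp add: xcoeff_cser) (subst card_Un_disjoint; auto)
qed

text \<open>The pairs of weight \<open>m\<close> form disjoint rectangles, one for each of the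
  finitely many splittings of \<open>m\<close>.\<close>

lemma cser_Times:
  assumes S: "locally_finite S w" and T: "locally_finite T v"
  shows "cser (S \<times> T) (\<lambda>(s, t). w s + v t) = cser S w * cser T v"
    and "locally_finite (S \<times> T) (\<lambda>(s, t). w s + v t)"
proof -
  let ?P = "\<lambda>m :: pos \<Rightarrow>\<^sub>0 nat. {(a, b). a + b = m}"
  let ?F = "\<lambda>p. {s \<in> S. w s = fst p} \<times> {t \<in> T. v t = snd p}"
  have eq: "{p \<in> S \<times> T. (case p of (s, t) \<Rightarrow> w s + v t) = m} = (\<Union>p\<in>?P m. ?F p)" for m
    by auto
  have fin: "finite (?F p)" for p
    using S T by (simp add: locally_finite_def)
  show "locally_finite (S \<times> T) (\<lambda>(s, t). w s + v t)"
    unfolding locally_finite_def eq using fin finite_splittings by blast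
  show "cser (S \<times> T) (\<lambda>(s, t). w s + v t) = cser S w * cser T v"
  proof (rule xseries_eqI)
    fix m
    have "card (\<Union>p\<in>?P m. ?F p) = (\<Sum>p\<in>?P m. card (?F p))"
      by (rule card_UN_disjoint) (use fin finite_splittings in \<open>auto simp: prod_eq_iff\<close>)
    then show "xcoeff (cser (S \<times> T) (\<lambda>(s, t). w s + v t)) m = xcoeff (cser S w * cser T v) m"
      unfolding xcoeff_cser times_xseries.rep_eq eq
      by (simp add: card_cartesian_product case_prod_unfold)
  qed
qed

text \<open>The power sum p_k, for positive \<open>k\<close>; at \<open>k = 0\<close> the family is
  not locally finite.\<close>

definition psum :: "nat \<Rightarrow> xseries" where
  "psum k = cser UNIV (\<lambda>j. Poly_Mapping.single j k)"

lemma locally_finite_single: "0 < k \<Longrightarrow> locally_finite UNIV (\<lambda>j. Poly_Mapping.single j k)"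
  unfolding locally_finite_def
proof
  fix m :: "pos \<Rightarrow>\<^sub>0 nat" assume "0 < k"
  then have "{j \<in> UNIV. Poly_Mapping.single j k = m} \<subseteq> Poly_Mapping.keys m"
    by auto
  then show "finite {j \<in> UNIV. Poly_Mapping.single j k = m}"
    by (rule finite_subset) simp
qed

text \<open>Neighbouring terms cancel and the hypothesis removes the upper boundary term.\<close>

lemma alternating_telescope:
  fixes A :: "nat \<Rightarrow> 'a :: comm_ring_1"
  assumes "A (Suc n) = 0"
  shows "(\<Sum>k\<in>{1..n}. (- 1) ^ (n - k) * (A k + A (Suc k))) = - ((- 1) ^ n * A 1)"
proof -
  \<comment> \<open>With the sign \<open>(- 1) ^ k\<close> the summand does not involve the upper
    bound, so induction on that bound applies.\<close>
  have *: "(\<Sum>k\<in>{1..m}. (- 1) ^ k * (A k + A (Suc k))) = - A 1 + (- 1) ^ m * A (Suc m)" for m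
    by (induction m) (simp_all add: algebra_simps)
  have "(\<Sum>k\<in>{1..n}. (- 1) ^ (n - k) * (A k + A (Suc k)))
      = (\<Sum>k\<in>{1..n}. (- 1) ^ n * ((- 1) ^ k * (A k + A (Suc k))))"
  proof (rule sum.cong)
    fix k assume "k \<in> {1..n}"
    then have "(- 1 :: 'a) ^ n = (- 1) ^ (n - k) * (- 1) ^ k"
      by (simp flip: power_add)
    then show "(- 1) ^ (n - k) * (A k + A (Suc k)) = (- 1) ^ n * ((- 1) ^ k * (A k + A (Suc k)))"
      by (simp add: mult.assoc flip: power_mult_distrib)
  qed simp
  also have "\<dots> = (- 1) ^ n * (\<Sum>k\<in>{1..n}. (- 1) ^ k * (A k + A (Suc k)))"
    by (rule sum_distrib_left[symmetric])
  finally show ?thesis unfolding * by (simp add: assms)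
qed

text \<open>A pair of a \<open>j\<close>-coloured block of size \<open>k\<close> and an object \<open>s\<close> containing \<open>j\<close> (in the sense of \<open>H\<close>)
  corresponds to a block of size \<open>k + 1\<close> and an object not containing \<open>j\<close>, by moving one \<open>j\<close>.\<close>

lemma psum_recursion:
  fixes S :: "nat \<Rightarrow> 's set" and H :: "pos \<Rightarrow> 's \<Rightarrow> bool"
  assumes fin: "\<And>l. locally_finite (S l) w"
    and H0: "\<And>j s. s \<in> S 0 \<Longrightarrow> \<not> H j s"
    and bij: "\<And>j l. bij_betw (ins j) {s \<in> S l. \<not> H j s} {s \<in> S (Suc l). H j s}"
    and w: "\<And>j l s. s \<in> S l \<Longrightarrow> \<not> H j s \<Longrightarrow> w (ins j s) = Poly_Mapping.single j 1 + w s"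
    and n: "n \<ge> 1"
  shows "(\<Sum>k\<in>{1..n}. psum k * ((- 1) ^ (n - k) * cser (S (n - k)) w))
    = - ((- 1) ^ n * cser {(j, s). s \<in> S n \<and> H j s} (w \<circ> snd))"
proof -
  define wt where "wt k = (\<lambda>(j, s). Poly_Mapping.single j k + w s)" for k
  \<comment> \<open>Pairs whose object avoids the colour of the block. The guard
    \<open>k \<le> n\<close> makes \<open>A (Suc n)\<close> vanish; truncated subtraction alone
    would yield \<open>S 0\<close> there.\<close>
  define A where "A k = cser {(j, s). k \<le> n \<and> s \<in> S (n - k) \<and> \<not> H j s} (wt k)" for k
  have bij': "bij_betw (\<lambda>(j, s). (j, ins j s)) {(j, s). s \<in> S l \<and> \<not> H j s}
      {(j, s). s \<in> S (Suc l) \<and> H j s}" for l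
    unfolding bij_betw_def
  proof
    show "inj_on (\<lambda>(j, s). (j, ins j s)) {(j, s). s \<in> S l \<and> \<not> H j s}"
      using bij_betw_imp_inj_on[OF bij] by (auto simp: inj_on_def)
    show "(\<lambda>(j, s). (j, ins j s)) ` {(j, s). s \<in> S l \<and> \<not> H j s} = {(j, s). s \<in> S (Suc l) \<and> H j s}"
    proof (intro set_eqI iffI)
      fix p assume "p \<in> (\<lambda>(j, s). (j, ins j s)) ` {(j, s). s \<in> S l \<and> \<not> H j s}"
      then show "p \<in> {(j, s). s \<in> S (Suc l) \<and> H j s}"
        using bij_betw_apply[OF bij] by fastforce
    next
      fix p assume p: "p \<in> {(j, s). s \<in> S (Suc l) \<and> H j s}"
      then have "snd p \<in> ins (fst p) ` {s \<in> S l. \<not> H (fst p) s}"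
        using bij_betw_imp_surj_on[OF bij] by auto
      then obtain s where "s \<in> S l" "\<not> H (fst p) s" "p = (fst p, ins (fst p) s)"
        by (auto simp: prod_eq_iff)
      then show "p \<in> (\<lambda>(j, s). (j, ins j s)) ` {(j, s). s \<in> S l \<and> \<not> H j s}"
        by (intro image_eqI[of _ _ "(fst p, s)"]) auto
    qed
  qed
  \<comment> \<open>For \<open>k < n\<close> one \<open>j\<close> moves from the object to the
    block. For \<open>k = n\<close> both sides vanish, by the guard and by
    \<open>H0\<close>.\<close>
  have A_Suc: "A (Suc k) = cser {(j, s). s \<in> S (n - k) \<and> H j s} (wt k)" if "k \<le> n" for k
  proof (cases "k = n")
    case True
    then have *: "{(j, s). s \<in> S (n - k) \<and> H j s} = {}" using H0 by auto
    show ?thesis unfolding * using True by (simp add: A_def cser_empty)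
  next
    case False
    with that have "k < n" by simp
    then have "n - k = Suc (n - Suc k)" by simp
    then have "bij_betw (\<lambda>(j, s). (j, ins j s)) {(j, s). Suc k \<le> n \<and> s \<in> S (n - Suc k) \<and> \<not> H j s}
        {(j, s). s \<in> S (n - k) \<and> H j s}"
      using bij'[of "n - Suc k"] \<open>k < n\<close> by simp
    then show ?thesis
      unfolding A_def
      by (rule cser_bij_betw) (auto simp: wt_def w[of _ "n - Suc k"] simp flip: add.assoc single_add)
  qed
  have B: "psum k * cser (S (n - k)) w = A k + A (Suc k)" if "k \<in> {1..n}" for k
  proof -
    note * = cser_Times[OF locally_finite_single[of k] fin[of "n - k"]]
    have split: "UNIV \<times> S (n - k) = {(j, s). k \<le> n \<and> s \<in> S (n - k) \<and> \<not> H j s}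
        \<union> {(j, s). s \<in> S (n - k) \<and> H j s}"
      using that by auto
    have "psum k * cser (S (n - k)) w = cser (UNIV \<times> S (n - k)) (wt k)"
      unfolding psum_def wt_def using that * by simp
    also have "\<dots> = A k + cser {(j, s). s \<in> S (n - k) \<and> H j s} (wt k)"
      unfolding A_def split
      by (rule cser_Un) (use that *(2) split in \<open>auto simp: wt_def\<close>)
    also have "\<dots> = A k + A (Suc k)" using A_Suc[of k] that by simp
    finally show ?thesis .
  qed
  have "(\<Sum>k\<in>{1..n}. psum k * ((- 1) ^ (n - k) * cser (S (n - k)) w))
      = (\<Sum>k\<in>{1..n}. (- 1) ^ (n - k) * (A k + A (Suc k)))"
    by (rule sum.cong) (simp_all only: mult.left_commute[of "psum _"] B)
  also have "\<dots> = - ((- 1) ^ n * A 1)"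
    by (rule alternating_telescope) (simp add: A_def cser_empty)
  \<comment> \<open>A block of size 0 has no weight, so what remains are the objects of size
    \<open>n\<close> marked with a colour they contain.\<close>
  also have "A 1 = cser {(j, s). s \<in> S n \<and> H j s} (wt 0)"
    using A_Suc[of 0] by simp
  also have "wt 0 = w \<circ> snd"
    by (auto simp: wt_def)
  finally show ?thesis .
qed

subsection \<open>Power sums\<close>

text \<open>A finite set is the support of its squarefree monomial, so every fibre has at most one
  element.\<close>

lemma esym_cser: "esym k = cser {T. finite T \<and> card T = k} (\<lambda>T. \<Sum>i\<in>T. Poly_Mapping.single i 1)"
  and locally_finite_sets:
    "locally_finite {T. finite T \<and> card T = k} (\<lambda>T. \<Sum>i\<in>T. Poly_Mapping.single i 1)"
proof -
  have *: "{T \<in> {T. finite T \<and> card T = k}. (\<Sum>i\<in>T. Poly_Mapping.single i 1) = m}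
      = (if card (Poly_Mapping.keys m) = k \<and> (\<forall>i. Poly_Mapping.lookup m i \<le> 1)
         then {Poly_Mapping.keys m} else {})" for m :: "pos \<Rightarrow>\<^sub>0 nat"
  proof -
    define Q where "Q \<longleftrightarrow> (\<forall>i. Poly_Mapping.lookup m i \<le> 1)"
    have "(\<Sum>i\<in>T. Poly_Mapping.single i 1) = m \<longleftrightarrow> Poly_Mapping.keys m = T \<and> Q" if "finite T" for T
      using eq_sum_single_iff[OF that, of m] unfolding Q_def by metis
    then have "{T \<in> {T. finite T \<and> card T = k}. (\<Sum>i\<in>T. Poly_Mapping.single i 1) = m}
        = {T. finite T \<and> card T = k \<and> Poly_Mapping.keys m = T \<and> Q}"
      by blast
    moreover have "{T. finite T \<and> card T = k \<and> K = T \<and> Q} = (if card K = k \<and> Q then {K} else {})"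
      if "finite K" for K :: "pos set"
      using that by auto
    ultimately show ?thesis unfolding Q_def[symmetric] by simp
  qed
  show "locally_finite {T. finite T \<and> card T = k} (\<lambda>T. \<Sum>i\<in>T. Poly_Mapping.single i 1)"
    unfolding locally_finite_def * by simp
  show "esym k = cser {T. finite T \<and> card T = k} (\<lambda>T. \<Sum>i\<in>T. Poly_Mapping.single i 1)"
    by (rule xseries_eqI) (simp only: xcoeff_cser * xcoeff_esym, simp)
qed

lemma xcoeff_of_nat_mult: "xcoeff (of_nat n * f) m = of_nat n * xcoeff f m"
  by (induction n) (simp_all add: distrib_right)

text \<open>In \<open>psum_recursion\<close> take finite sets with membership as \<open>H\<close>.
  The surviving pairs are \<open>n\<close>-element sets with a marked element, whence the factor
  \<open>n\<close>.\<close>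

lemma Newton_esym:
  assumes "n \<ge> 1"
  shows "(\<Sum>k\<in>{1..n}. psum k * ((- 1) ^ (n - k) * esym (n - k))) = - ((- 1) ^ n * (of_nat n * esym n))"
proof -
  let ?S = "\<lambda>k. {T :: pos set. finite T \<and> card T = k}"
  let ?w = "\<lambda>T :: pos set. \<Sum>i\<in>T. Poly_Mapping.single i (1::nat)"
  have "(\<Sum>k\<in>{1..n}. psum k * ((- 1) ^ (n - k) * cser (?S (n - k)) ?w))
    = - ((- 1) ^ n * cser {(j, T). T \<in> ?S n \<and> j \<in> T} (?w \<circ> snd))"
  proof (rule psum_recursion[where ins = insert])
    show "bij_betw (insert j) {T \<in> ?S l. j \<notin> T} {T \<in> ?S (Suc l). j \<in> T}" for j l
      by (rule bij_betw_byWitness[where f' = "\<lambda>T. T - {j}"]) (auto simp: card_insert_if)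
  qed (use assms locally_finite_sets in auto)
  moreover have "cser {(j, T). T \<in> ?S n \<and> j \<in> T} (?w \<circ> snd) = of_nat n * cser (?S n) ?w"
  proof (rule xseries_eqI)
    fix m
    have fin: "finite {T \<in> ?S n. ?w T = m}"
      using locally_finite_sets unfolding locally_finite_def by blast
    have "bij_betw prod.swap (SIGMA T:{T \<in> ?S n. ?w T = m}. T)
        {p \<in> {(j, T). T \<in> ?S n \<and> j \<in> T}. (?w \<circ> snd) p = m}"
      by (rule bij_betw_byWitness[where f' = prod.swap]) auto
    then have "card {p \<in> {(j, T). T \<in> ?S n \<and> j \<in> T}. (?w \<circ> snd) p = m}
        = card (SIGMA T:{T \<in> ?S n. ?w T = m}. T)"
      by (rule bij_betw_same_card[symmetric])
    also have "\<dots> = (\<Sum>T\<in>{T \<in> ?S n. ?w T = m}. card T)"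
      by (rule card_SigmaI[OF fin]) auto
    also have "\<dots> = (\<Sum>T\<in>{T \<in> ?S n. ?w T = m}. n)"
      by (rule sum.cong) auto
    finally show "xcoeff (cser {(j, T). T \<in> ?S n \<and> j \<in> T} (?w \<circ> snd)) m
        = xcoeff (of_nat n * cser (?S n) ?w) m"
      by (simp add: xcoeff_cser xcoeff_of_nat_mult mult.commute)
  qed
  ultimately show ?thesis
    by (simp add: esym_cser)
qed

lemma xscale_sign: "xscale ((- 1) ^ k) f = (- 1) ^ k * f"
proof (induction k)
  case (Suc k)
  have "xscale (- c) f = - xscale c f" for c
    by (rule xseries_eqI) (simp add: uminus_xseries.rep_eq)
  then show ?case using Suc by simp
qed (simp add: xscale_simps)

text \<open>Multiplying t L \<sigma>' = - t L' \<sigma> by L on the right cancels \<sigma>; the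
  result has the shape of \<open>Newton_esym\<close>.\<close>

lemma Newton_Psi:
  assumes "n \<ge> 1"
  shows "(\<Sum>k\<in>{1..n}. Psi k * ((- 1) ^ (n - k) \<odot> Lam (n - k))) = - (of_nat n * ((- 1) ^ n \<odot> Lam n))"
proof -
  have "fps_X * (lam_neg * fps_deriv sigma_gf) * lam_neg = - (fps_X * fps_deriv lam_neg)"
    by (simp add: lam_neg_deriv mult.assoc sigma_gf_inverse)
  then have "fps_nth (fps_X * (lam_neg * fps_deriv sigma_gf) * lam_neg) n
      = - fps_nth (fps_X * fps_deriv lam_neg) n"
    by simp
  moreover have "fps_nth (fps_X * fps_deriv lam_neg) n = of_nat n * ((- 1) ^ n \<odot> Lam n)"
    unfolding lam_neg_nth[symmetric] using assms by (cases n) simp_all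
  moreover have "fps_nth (fps_X * (lam_neg * fps_deriv sigma_gf) * lam_neg) n
      = (\<Sum>k\<in>{1..n}. Psi k * ((- 1) ^ (n - k) \<odot> Lam (n - k)))"
    unfolding fps_mult_nth[of _ lam_neg]
    by (simp add: sum.atLeast_Suc_atMost[of 0] lam_neg_nth Psi_def)
  ultimately show ?thesis by simp
qed

lemma rho_uminus: "rho (- f) = - rho f"
  using rho_add[of f "- f"] by (simp add: rho_0 add_eq_0_iff)

lemma rho_of_nat: "rho (of_nat n) = of_nat n"
  by (induction n) (simp_all add: rho_0 rho_add rho_1)

text \<open>Both sides satisfy Newton's identities, and these determine the term
  \<open>k = n\<close> from the earlier ones because its other factor is
  \<open>esym 0 = 1\<close>.\<close>

lemma rho_Psi: "k \<ge> 1 \<Longrightarrow> rho (Psi k) = psum k"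
proof (induction k rule: less_induct)
  case (less n)
  have last: "(\<Sum>k\<in>{1..n}. f k) = (\<Sum>k\<in>{1..<n}. f k) + f n" for f :: "nat \<Rightarrow> xseries"
    using less.prems by (metis sum.last_plus add.commute)
  have "(\<Sum>k\<in>{1..n}. rho (Psi k) * ((- 1) ^ (n - k) * esym (n - k)))
      = rho (\<Sum>k\<in>{1..n}. Psi k * ((- 1) ^ (n - k) \<odot> Lam (n - k)))"
    by (simp add: rho_sum rho_mult rho_nscale rho_Lam xscale_sign)
  also have "\<dots> = - ((- 1) ^ n * (of_nat n * esym n))"
    unfolding Newton_Psi[OF less.prems]
    by (simp add: rho_uminus rho_mult rho_of_nat rho_nscale rho_Lam xscale_sign mult.left_commute)
  also have "\<dots> = (\<Sum>k\<in>{1..n}. psum k * ((- 1) ^ (n - k) * esym (n - k)))"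
    using Newton_esym[OF less.prems] by simp
  finally show ?case
    unfolding last using less.IH by (simp add: esym_0)
qed

subsection \<open>The chromatic symmetric function of the path\<close>

text \<open>Proper colourings of the path, read from the first vertex to the last.\<close>

definition words :: "nat \<Rightarrow> pos list set" where
  "words n = {xs. length xs = n \<and> distinct_adj xs}"

definition word_wt :: "pos list \<Rightarrow> (pos \<Rightarrow>\<^sub>0 nat)" where
  "word_wt xs = (\<Sum>i\<leftarrow>xs. Poly_Mapping.single i 1)"

lemma locally_finite_words: "locally_finite (words n) word_wt"
  unfolding locally_finite_def
proof
  fix m
  have "set xs \<subseteq> Poly_Mapping.keys (word_wt xs)" for xs
    by (induction xs) (auto simp: word_wt_def in_keys_iff lookup_add lookup_single)
  then have "{xs \<in> words n. word_wt xs = m} \<subseteq> {xs. set xs \<subseteq> Poly_Mapping.keys m \<and> length xs = n}"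
    by (auto simp: words_def)
  then show "finite {xs \<in> words n. word_wt xs = m}"
    by (rule finite_subset) (simp add: finite_lists_length_eq)
qed

lemma chromatic_path: "chromatic_sym (path_graph n) = cser (words n) word_wt"
proof (rule xseries_eqI)
  fix m
  let ?C = "proper_colorings (path_graph n)"
  let ?g = "\<lambda>c :: nat \<Rightarrow> pos. map c [1..<Suc n]"
  have "cser ?C (\<lambda>c. \<Sum>v\<in>{1..n}. Poly_Mapping.single (c v) 1) = cser (words n) word_wt"
  proof (rule cser_bij_betw)
    show "bij_betw ?g ?C (words n)"
    \<comment> \<open>Vertices are numbered from 1 and list positions from 0, hence the shift by
      one.\<close>
    proof (rule bij_betw_byWitness[where f' = "\<lambda>xs. \<lambda>i\<in>{1..n}. xs ! (i - 1)"])
      show "\<forall>c\<in>?C. (\<lambda>i\<in>{1..n}. ?g c ! (i - 1)) = c"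
        by (auto simp: proper_colorings_def path_graph_def PiE_def extensional_def fun_eq_iff
            simp del: upt_Suc)
      show "\<forall>xs\<in>words n. ?g (\<lambda>i\<in>{1..n}. xs ! (i - 1)) = xs"
        by (auto simp: words_def list_eq_iff_nth_eq simp del: upt_Suc)
      show "?g ` ?C \<subseteq> words n"
      proof (rule image_subsetI)
        fix c assume c: "c \<in> ?C"
        have "c (Suc i) \<noteq> c (Suc (Suc i))" if "Suc i < n" for i
        proof -
          have "{Suc i, Suc (Suc i)} \<in> snd (path_graph n)"
            using that unfolding path_graph_def by (auto intro!: exI[of _ "Suc i"])
          then show ?thesis
            using c that unfolding proper_colorings_def by (auto simp: path_graph_def)
        qed
        then show "?g c \<in> words n"
          by (auto simp: words_def distinct_adj_conv_nth simp del: upt_Suc)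
      qed
      show "(\<lambda>xs. \<lambda>i\<in>{1..n}. xs ! (i - 1)) ` words n \<subseteq> ?C"
      proof (rule image_subsetI)
        fix xs assume xs: "xs \<in> words n"
        have adj: "xs ! (i - 1) \<noteq> xs ! i" if "1 \<le> i" "i < n" for i
          using xs that distinct_adj_nth[of xs "i - 1"] by (simp add: words_def)
        have "(\<lambda>i\<in>{1..n}. xs ! (i - 1)) u \<noteq> (\<lambda>i\<in>{1..n}. xs ! (i - 1)) v"
          if uv: "{u, v} \<in> snd (path_graph n)" "u \<in> {1..n}" "v \<in> {1..n}" for u v
        proof -
          obtain i where "{u, v} = {i, i + 1}" "1 \<le> i" "i < n"
            using uv(1) by (auto simp: path_graph_def)
          then show ?thesis
            using adj[of i] uv by (auto simp: doubleton_eq_iff)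
        qed
        then show "(\<lambda>i\<in>{1..n}. xs ! (i - 1)) \<in> ?C"
          unfolding proper_colorings_def by (auto simp: path_graph_def)
      qed
    qed
    show "word_wt (?g c) = (\<Sum>v\<in>{1..n}. Poly_Mapping.single (c v) 1)" for c
      unfolding word_wt_def map_map comp_def interv_sum_list_conv_sum_set_nat
      by (rule sum.cong) auto
  qed
  then show "xcoeff (chromatic_sym (path_graph n)) m = xcoeff (cser (words n) word_wt) m"
    by (simp add: xcoeff_chromatic_sym path_graph_def flip: xcoeff_cser)
qed

text \<open>In \<open>psum_recursion\<close> let \<open>H\<close> say that the word starts with
  \<open>j\<close>: prepending \<open>j\<close> to a word that does not start with it keeps
  neighbours distinct. A nonempty word has exactly one first colour, so no multiplicity
  appears.\<close>

lemma chromatic_path_recursion: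
  assumes "n \<ge> 1"
  shows "(\<Sum>k\<in>{1..n}. psum k * ((- 1) ^ (n - k) * chromatic_sym (path_graph (n - k))))
    = - ((- 1) ^ n * chromatic_sym (path_graph n))"
proof -
  have "(\<Sum>k\<in>{1..n}. psum k * ((- 1) ^ (n - k) * cser (words (n - k)) word_wt))
    = - ((- 1) ^ n * cser {(j, xs). xs \<in> words n \<and> (xs \<noteq> [] \<and> hd xs = j)} (word_wt \<circ> snd))"
  proof (rule psum_recursion[where ins = Cons])
    show "bij_betw (Cons j) {xs \<in> words l. \<not> (xs \<noteq> [] \<and> hd xs = j)}
        {xs \<in> words (Suc l). xs \<noteq> [] \<and> hd xs = j}" for j l
      by (rule bij_betw_byWitness[where f' = tl])
        (auto simp: words_def distinct_adj_Cons length_Suc_conv)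
    show "locally_finite (words l) word_wt" for l
      by (rule locally_finite_words)
  qed (use assms in \<open>auto simp: words_def word_wt_def\<close>)
  also have "cser {(j, xs). xs \<in> words n \<and> (xs \<noteq> [] \<and> hd xs = j)} (word_wt \<circ> snd)
      = cser (words n) word_wt"
  proof (rule cser_bij_betw)
    show "bij_betw snd {(j, xs). xs \<in> words n \<and> (xs \<noteq> [] \<and> hd xs = j)} (words n)"
      by (rule bij_betw_byWitness[where f' = "\<lambda>xs. (hd xs, xs)"])
        (use assms in \<open>auto simp: words_def\<close>)
  qed simp
  finally show ?thesis by (simp add: chromatic_path)
qed

text \<open>Since \<open>rho\<close> sends \<open>Psi k\<close> to \<open>psum k\<close>, splitting
  off the first part of a composition becomes the recursion
  \<open>chromatic_path_recursion\<close>.\<close>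

lemma rho_X_neg: "rho (fps_nth X_neg n) = (- 1) ^ n * chromatic_sym (path_graph n)"
proof (induction n rule: less_induct)
  case (less n)
  show ?case
  proof (cases "n = 0")
    case True
    have "chromatic_sym (path_graph 0) = 1"
      by (rule xseries_eqI) (auto simp: chromatic_path xcoeff_cser words_def word_wt_def
          conj_commute cong: conj_cong)
    then show ?thesis using True by (simp add: X_neg_def clists_0 rho_1)
  next
    case False
    then have "fps_nth X_neg n = - (\<Sum>k\<in>{1..n}. Psi k * fps_nth X_neg (n - k))"
      using sum_prod_clists_Cons[of n "\<lambda>k. - Psi k"] by (simp add: X_neg_def sum_negf)
    then have "rho (fps_nth X_neg n) = - (\<Sum>k\<in>{1..n}. rho (Psi k) * rho (fps_nth X_neg (n - k)))"
      by (simp add: rho_uminus rho_sum rho_mult)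
    also have "(\<Sum>k\<in>{1..n}. rho (Psi k) * rho (fps_nth X_neg (n - k)))
        = (\<Sum>k\<in>{1..n}. psum k * ((- 1) ^ (n - k) * chromatic_sym (path_graph (n - k))))"
      using less by (intro sum.cong) (simp_all add: rho_Psi)
    also have "- \<dots> = (- 1) ^ n * chromatic_sym (path_graph n)"
      using chromatic_path_recursion[of n] False by simp
    finally show ?thesis .
  qed
qed

lemma rho_Xtilde: "rho (Xtilde n) = chromatic_sym (path_graph n)"
  unfolding Xtilde_conv rho_nscale rho_X_neg xscale_sign
  by (simp flip: mult.assoc power_mult_distrib)

theorem theorem3p3:
  fixes n :: nat
  assumes "n \<ge> 1"
  shows "rho (Xtilde n) = chromatic_sym (path_graph n) \<and>
    Xtilde n = (\<Sum>I\<in>compositions n.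
      (of_nat (hd (parts I)) * (\<Prod>i\<leftarrow>tl (parts I). of_nat i - 1)) \<odot> npow Lam I) \<and>
    Xtilde n = (1 / 2) \<odot> (\<Sum>I\<in>C12 n. 2 ^ m1 I \<odot> ribbon I)"
  using rho_Xtilde Xtilde_Lam[OF assms] Xtilde_ribbon[OF assms] by blast

end
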